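(* The equivalence between $\mathbf{SchCat}(\mathbf{RPOGrp})$ and $\mathcal S\text{-}\mathbf{XMod}(\mathbf{RPOGrp})$, which sends a Schreier internal category $(X_0,X_1,d,c,e,m)$ to the $\mathcal S$-crossed module with underlying right-preordered groups $\mathrm{Ker}(d)$ and $X_0$, $\partial=c|_{\mathrm{Ker}(d)}$ and $\mu(y)(x)=e(y)+x-e(y)$, restricts to an equivalence between the full subcategory $\mathbf{SchGrpd}(\mathbf{RPOGrp})$ of Schreier internal categories that are internal groupoids in $\mathbf{RPOGrp}$ and the full subcategory of $\mathcal S$-crossed modules $(X_1,X_0,\mu,\partial)$ whose positive cone $P_{X_1}$ is a group. In particular, a Schreier internal category $(X_0,X_1,d,c,e,m)$ is an internal groupoid if and only if the monoid $\ker(d)\cap P_{X_1}$ is a group.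
   Context: Groups are written additively and need not be abelian. A right-preordered group is a pair $(G,P_G)$ with $G$ a group and $P_G$ a submonoid of $G$ (the positive cone). Morphisms $(G,P_G)\to(H,P_H)$ in $\mathbf{RPOGrp}$ are group homomorphisms $f$ with $f(P_G)\subseteq P_H$. Limits are computed separately on groups and on positive cones; $\mathrm{Ker}(f)=(\ker f,\ker f\cap P_G)$. A split epimorphism $d:(X_1,P_1)\to(X_0,P_0)$ with section $e$ in $\mathbf{RPOGrp}$ is Schreier if $a-e(d(a))\in P_1$ for all $a\in P_1$. A Schreier internal category is an internal category in $\mathbf{RPOGrp}$ (domain $d$, codomain $c$, identities $e$, composition $m$) such that $(d,e)$ is a Schreier split epimorphism; $\mathbf{SchCat}(\mathbf{RPOGrp})$ is the category of these with internal functors. It is an internal groupoid if there is a morphism $\sigma:X_1\to X_1$ in $\mathbf{RPOGrp}$ giving inverses for composition ($d\sigma=c$, $c\sigma=d$, $m(a,\sigma(a))=ec(a)$, $m(\sigma(a),a)=ed(a)$). For a right-preordered group $(K,P_K)$, $[K,P_K]_{\mathcal S}:=(\mathrm{Aut}(K),\mathrm{Aut}(K)_{\le})$, with $\mathrm{Aut}(K)$ the group of all group automorphisms of $K$ and $\mathrm{Aut}(K)_\le$ the submonoid of those $f$ with $f(P_K)\subseteq P_K$. An $\mathcal S$-crossed module $(X_1,X_0,\mu,\partial)$ consists of right-preordered groups $(X_0,P_{X_0})$, $(X_1,P_{X_1})$ and morphisms $\partial:(X_1,P_{X_1})\to(X_0,P_{X_0})$, $\mu:(X_0,P_{X_0})\to[X_1,P_{X_1}]_{\mathcal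 S}$ of $\mathbf{RPOGrp}$ such that $\partial(\mu(x)(a))=x+\partial(a)-x$ and $\mu(\partial(a))(b)=a+b-a$ for all $a,b\in X_1,x\in X_0$. Morphisms are pairs $(\gamma_0:X_0\to X_0',\gamma_1:X_1\to X_1')$ of morphisms of $\mathbf{RPOGrp}$ with $\gamma_0\partial=\partial'\gamma_1$ and $\gamma_1(\mu(x)(a))=\mu'(\gamma_0(x))(\gamma_1(a))$. These form the category $\mathcal S\text{-}\mathbf{XMod}(\mathbf{RPOGrp})$. A submonoid of a group is "a group" if it is closed under inverses. The equivalence sends an internal functor $(f_0,f_1)$ to $(f_0,f_1|_{\mathrm{Ker}(d)})$. *)

theory Defs
  imports "HOL-Algebra.Bij" "HOL-Algebra.Coset"
begin

section \<open>Categories, functors, equivalences\<close>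

text \<open>
  Hom-sets need not be disjoint, so composition and the arrow part of a functor take
  the objects involved as arguments: in \<open>Comp C X Y Z g f\<close> we have
  \<open>f : X \<rightarrow> Y\<close> and \<open>g : Y \<rightarrow> Z\<close>.
\<close>

record ('o, 'm) cat =
  Obj :: "'o set"
  Hom :: "'o \<Rightarrow> 'o \<Rightarrow> 'm set"
  Id :: "'o \<Rightarrow> 'm"
  Comp :: "'o \<Rightarrow> 'o \<Rightarrow> 'o \<Rightarrow> 'm \<Rightarrow> 'm \<Rightarrow> 'm"

definition category :: "('o, 'm) cat \<Rightarrow> bool" where
  "category C \<longleftrightarrow>
    (\<forall>X\<in>Obj C. Id C X \<in> Hom C X X) \<and>
    (\<forall>X\<in>Obj C. \<forall>Y\<in>Obj C. \<forall>Z\<in>Obj C. \<forall>f\<in>Hom C X Y. \<forall>g\<in>Hom C Y Z.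
       Comp C X Y Z g f \<in> Hom C X Z) \<and>
    (\<forall>X\<in>Obj C. \<forall>Y\<in>Obj C. \<forall>f\<in>Hom C X Y.
       Comp C X X Y f (Id C X) = f \<and> Comp C X Y Y (Id C Y) f = f) \<and>
    (\<forall>W\<in>Obj C. \<forall>X\<in>Obj C. \<forall>Y\<in>Obj C. \<forall>Z\<in>Obj C.
       \<forall>f\<in>Hom C W X. \<forall>g\<in>Hom C X Y. \<forall>h\<in>Hom C Y Z.
       Comp C W X Z (Comp C X Y Z h g) f = Comp C W Y Z h (Comp C W X Y g f))"

definition full_subcat :: "('o, 'm) cat \<Rightarrow> ('o \<Rightarrow> bool) \<Rightarrow> ('o, 'm) cat" where
  "full_subcat C S = C\<lparr>Obj := {X \<in> Obj C. S X}\<rparr>"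

definition iso_arrow :: "('o, 'm) cat \<Rightarrow> 'o \<Rightarrow> 'o \<Rightarrow> 'm \<Rightarrow> bool" where
  "iso_arrow C X Y f \<longleftrightarrow> f \<in> Hom C X Y \<and>
    (\<exists>g\<in>Hom C Y X. Comp C X Y X g f = Id C X \<and> Comp C Y X Y f g = Id C Y)"

definition cat_functor ::
  "('o, 'm) cat \<Rightarrow> ('p, 'n) cat \<Rightarrow> ('o \<Rightarrow> 'p) \<Rightarrow> ('o \<Rightarrow> 'o \<Rightarrow> 'm \<Rightarrow> 'n) \<Rightarrow> bool" where
  "cat_functor C D FO FM \<longleftrightarrow> category C \<and> category D \<and>
    (\<forall>X\<in>Obj C. FO X \<in> Obj D) \<and>
    (\<forall>X\<in>Obj C. \<forall>Y\<in>Obj C. \<forall>f\<in>Hom C X Y. FM X Y f \<in> Hom D (FO X) (FO Y)) \<and>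
    (\<forall>X\<in>Obj C. FM X X (Id C X) = Id D (FO X)) \<and>
    (\<forall>X\<in>Obj C. \<forall>Y\<in>Obj C. \<forall>Z\<in>Obj C. \<forall>f\<in>Hom C X Y. \<forall>g\<in>Hom C Y Z.
       FM X Z (Comp C X Y Z g f) = Comp D (FO X) (FO Y) (FO Z) (FM Y Z g) (FM X Y f))"

definition natural_iso ::
  "('o, 'm) cat \<Rightarrow> ('p, 'n) cat \<Rightarrow>
   ('o \<Rightarrow> 'p) \<Rightarrow> ('o \<Rightarrow> 'o \<Rightarrow> 'm \<Rightarrow> 'n) \<Rightarrow>
   ('o \<Rightarrow> 'p) \<Rightarrow> ('o \<Rightarrow> 'o \<Rightarrow> 'm \<Rightarrow> 'n) \<Rightarrow> ('o \<Rightarrow> 'n) \<Rightarrow> bool" where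
  "natural_iso C D FO FM GO GM \<eta> \<longleftrightarrow>
    cat_functor C D FO FM \<and> cat_functor C D GO GM \<and>
    (\<forall>X\<in>Obj C. iso_arrow D (FO X) (GO X) (\<eta> X)) \<and>
    (\<forall>X\<in>Obj C. \<forall>Y\<in>Obj C. \<forall>f\<in>Hom C X Y.
       Comp D (FO X) (FO Y) (GO Y) (\<eta> Y) (FM X Y f) =
       Comp D (FO X) (GO X) (GO Y) (GM X Y f) (\<eta> X))"

definition cat_equivalence ::
  "('o, 'm) cat \<Rightarrow> ('p, 'n) cat \<Rightarrow> ('o \<Rightarrow> 'p) \<Rightarrow> ('o \<Rightarrow> 'o \<Rightarrow> 'm \<Rightarrow> 'n) \<Rightarrow> bool" where
  "cat_equivalence C D FO FM \<longleftrightarrow> cat_functor C D FO FM \<and>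
    (\<exists>GO GM \<eta> \<epsilon>. cat_functor D C GO GM \<and>
       natural_iso C C (\<lambda>X. X) (\<lambda>X Y f. f)
         (\<lambda>X. GO (FO X)) (\<lambda>X Y f. GM (FO X) (FO Y) (FM X Y f)) \<eta> \<and>
       natural_iso D D (\<lambda>A. FO (GO A)) (\<lambda>A B g. FM (GO A) (GO B) (GM A B g))
         (\<lambda>A. A) (\<lambda>A B g. g) \<epsilon>)"


section \<open>Right-preordered groups\<close>

text \<open>
  Groups are not assumed abelian. They are written multiplicatively, as everywhere in
  HOL-Algebra: \<open>x + a - x\<close> becomes \<open>x \<otimes> a \<otimes> inv x\<close>.
\<close>

record 'a rpogrp = "'a monoid" +
  pcone :: "'a set"

definition rpogroup :: "'a rpogrp \<Rightarrow> bool" where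
  "rpogroup G \<longleftrightarrow> group G \<and> submonoid (pcone G) G"

text \<open>
  Morphisms are extensional functions (\<open>undefined\<close> off the carrier), so that equality of
  morphisms is equality of functions.
\<close>

definition rpo_hom :: "'a rpogrp \<Rightarrow> 'b rpogrp \<Rightarrow> ('a \<Rightarrow> 'b) set" where
  "rpo_hom G H = {f \<in> hom G H. f \<in> extensional (carrier G) \<and> f ` pcone G \<subseteq> pcone H}"

definition rpo_kernel :: "'a rpogrp \<Rightarrow> 'b rpogrp \<Rightarrow> ('a \<Rightarrow> 'b) \<Rightarrow> 'a rpogrp" where
  "rpo_kernel G H f =
    G\<lparr>carrier := kernel G H f, pcone := kernel G H f \<inter> pcone G\<rparr>"

definition rpo_pullback ::
  "'a rpogrp \<Rightarrow> 'b rpogrp \<Rightarrow> ('a \<Rightarrow> 'c) \<Rightarrow> ('b \<Rightarrow> 'c) \<Rightarrow> ('a \<times> 'b) rpogrp" where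
  "rpo_pullback G H f g =
    \<lparr>carrier = {(a, b) \<in> carrier G \<times> carrier H. f a = g b},
     mult = mult (G \<times>\<times> H),
     one = one (G \<times>\<times> H),
     pcone = {(a, b) \<in> pcone G \<times> pcone H. f a = g b}\<rparr>"

text \<open>The object \<open>[K, P\<^sub>K]\<^sub>S\<close>; the multiplication of \<^const>\<open>AutoGroup\<close> is
  \<open>g \<otimes> f = g \<circ> f\<close>.\<close>

definition rpo_Aut :: "'a rpogrp \<Rightarrow> ('a \<Rightarrow> 'a) rpogrp" where
  "rpo_Aut K =
    \<lparr>carrier = carrier (AutoGroup K),
     mult = mult (AutoGroup K),
     one = one (AutoGroup K),
     pcone = {f \<in> carrier (AutoGroup K). f ` pcone K \<subseteq> pcone K}\<rparr>"

text \<open>To be applied to submonoids \<open>M\<close> of \<open>G\<close>.\<close>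

definition is_a_group :: "'a rpogrp \<Rightarrow> 'a set \<Rightarrow> bool" where
  "is_a_group G M \<longleftrightarrow> (\<forall>a\<in>M. inv\<^bsub>G\<^esub> a \<in> M)"


section \<open>Schreier internal categories\<close>

definition schreier_split_epi ::
  "'b rpogrp \<Rightarrow> 'a rpogrp \<Rightarrow> ('b \<Rightarrow> 'a) \<Rightarrow> ('a \<Rightarrow> 'b) \<Rightarrow> bool" where
  "schreier_split_epi A B d e \<longleftrightarrow>
    d \<in> rpo_hom A B \<and> e \<in> rpo_hom B A \<and> (\<forall>x\<in>carrier B. d (e x) = x) \<and>
    (\<forall>a\<in>pcone A. a \<otimes>\<^bsub>A\<^esub> inv\<^bsub>A\<^esub> (e (d a)) \<in> pcone A)"

record ('a, 'b) intcat =
  ob :: "'a rpogrp"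
  ar :: "'b rpogrp"
  dm :: "'b \<Rightarrow> 'a"
  cd :: "'b \<Rightarrow> 'a"
  idt :: "'a \<Rightarrow> 'b"
  cmp :: "'b \<times> 'b \<Rightarrow> 'b"

text \<open>\<open>cmp X (a, b)\<close> is "\<open>a\<close> after \<open>b\<close>", defined when \<open>dm X a = cd X b\<close>.\<close>

definition composable :: "('a, 'b) intcat \<Rightarrow> ('b \<times> 'b) rpogrp" where
  "composable X = rpo_pullback (ar X) (ar X) (dm X) (cd X)"

definition internal_category :: "('a, 'b) intcat \<Rightarrow> bool" where
  "internal_category X \<longleftrightarrow>
    rpogroup (ob X) \<and> rpogroup (ar X) \<and>
    dm X \<in> rpo_hom (ar X) (ob X) \<and>
    cd X \<in> rpo_hom (ar X) (ob X) \<and>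
    idt X \<in> rpo_hom (ob X) (ar X) \<and>
    cmp X \<in> rpo_hom (composable X) (ar X) \<and>
    (\<forall>x\<in>carrier (ob X). dm X (idt X x) = x \<and> cd X (idt X x) = x) \<and>
    (\<forall>(a, b)\<in>carrier (composable X).
       dm X (cmp X (a, b)) = dm X b \<and> cd X (cmp X (a, b)) = cd X a) \<and>
    (\<forall>a\<in>carrier (ar X).
       cmp X (idt X (cd X a), a) = a \<and> cmp X (a, idt X (dm X a)) = a) \<and>
    (\<forall>a\<in>carrier (ar X). \<forall>b\<in>carrier (ar X). \<forall>c\<in>carrier (ar X).
       dm X a = cd X b \<longrightarrow> dm X b = cd X c \<longrightarrow>
       cmp X (cmp X (a, b), c) = cmp X (a, cmp X (b, c)))"

definition schreier_category :: "('a, 'b) intcat \<Rightarrow> bool" where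
  "schreier_category X \<longleftrightarrow>
    internal_category X \<and> schreier_split_epi (ar X) (ob X) (dm X) (idt X)"

definition internal_groupoid :: "('a, 'b) intcat \<Rightarrow> bool" where
  "internal_groupoid X \<longleftrightarrow> internal_category X \<and>
    (\<exists>\<sigma>\<in>rpo_hom (ar X) (ar X). \<forall>a\<in>carrier (ar X).
       dm X (\<sigma> a) = cd X a \<and> cd X (\<sigma> a) = dm X a \<and>
       cmp X (a, \<sigma> a) = idt X (cd X a) \<and> cmp X (\<sigma> a, a) = idt X (dm X a))"

definition internal_functors ::
  "('a, 'b) intcat \<Rightarrow> ('c, 'd) intcat \<Rightarrow> (('a \<Rightarrow> 'c) \<times> ('b \<Rightarrow> 'd)) set" where
  "internal_functors X Y =
    {(f0, f1). f0 \<in> rpo_hom (ob X) (ob Y) \<and> f1 \<in> rpo_hom (ar X) (ar Y) \<and>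
       (\<forall>a\<in>carrier (ar X). dm Y (f1 a) = f0 (dm X a) \<and> cd Y (f1 a) = f0 (cd X a)) \<and>
       (\<forall>x\<in>carrier (ob X). f1 (idt X x) = idt Y (f0 x)) \<and>
       (\<forall>(a, b)\<in>carrier (composable X). f1 (cmp X (a, b)) = cmp Y (f1 a, f1 b))}"

text \<open>
  The carrier types play the role of a universe. For the equivalence below both are the same
  infinite type, so that the universe contains, up to isomorphism, the semidirect product of
  any two of its members.
\<close>

definition SchCat :: "(('a, 'b) intcat, ('a \<Rightarrow> 'a) \<times> ('b \<Rightarrow> 'b)) cat" where
  "SchCat =
    \<lparr>Obj = {X. schreier_category X},
     Hom = internal_functors,
     Id = (\<lambda>X. (\<lambda>x\<in>carrier (ob X). x, \<lambda>a\<in>carrier (ar X). a)),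
     Comp = (\<lambda>X Y Z (g0, g1) (f0, f1).
       (compose (carrier (ob X)) g0 f0, compose (carrier (ar X)) g1 f1))\<rparr>"

definition SchGrpd :: "(('a, 'b) intcat, ('a \<Rightarrow> 'a) \<times> ('b \<Rightarrow> 'b)) cat" where
  "SchGrpd = full_subcat SchCat internal_groupoid"


section \<open>Crossed modules\<close>

record ('a, 'b) xmod =
  base :: "'a rpogrp"
  fibre :: "'b rpogrp"
  act :: "'a \<Rightarrow> 'b \<Rightarrow> 'b"
  bdry :: "'b \<Rightarrow> 'a"

definition crossed_module :: "('a, 'b) xmod \<Rightarrow> bool" where
  "crossed_module M \<longleftrightarrow>
    rpogroup (base M) \<and> rpogroup (fibre M) \<and>
    bdry M \<in> rpo_hom (fibre M) (base M) \<and>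
    act M \<in> rpo_hom (base M) (rpo_Aut (fibre M)) \<and>
    (\<forall>x\<in>carrier (base M). \<forall>a\<in>carrier (fibre M).
       bdry M (act M x a) = x \<otimes>\<^bsub>base M\<^esub> bdry M a \<otimes>\<^bsub>base M\<^esub> inv\<^bsub>base M\<^esub> x) \<and>
    (\<forall>a\<in>carrier (fibre M). \<forall>b\<in>carrier (fibre M).
       act M (bdry M a) b = a \<otimes>\<^bsub>fibre M\<^esub> b \<otimes>\<^bsub>fibre M\<^esub> inv\<^bsub>fibre M\<^esub> a)"

definition xmod_homs ::
  "('a, 'b) xmod \<Rightarrow> ('c, 'd) xmod \<Rightarrow> (('a \<Rightarrow> 'c) \<times> ('b \<Rightarrow> 'd)) set" where
  "xmod_homs M N =
    {(g0, g1). g0 \<in> rpo_hom (base M) (base N) \<and> g1 \<in> rpo_hom (fibre M) (fibre N) \<and>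
       (\<forall>a\<in>carrier (fibre M). g0 (bdry M a) = bdry N (g1 a)) \<and>
       (\<forall>x\<in>carrier (base M). \<forall>a\<in>carrier (fibre M).
          g1 (act M x a) = act N (g0 x) (g1 a))}"

definition XMod :: "(('a, 'b) xmod, ('a \<Rightarrow> 'a) \<times> ('b \<Rightarrow> 'b)) cat" where
  "XMod =
    \<lparr>Obj = {M. crossed_module M},
     Hom = xmod_homs,
     Id = (\<lambda>M. (\<lambda>x\<in>carrier (base M). x, \<lambda>a\<in>carrier (fibre M). a)),
     Comp = (\<lambda>L M N (h0, h1) (g0, g1).
       (compose (carrier (base L)) h0 g0, compose (carrier (fibre L)) h1 g1))\<rparr>"

definition XModGrp :: "(('a, 'b) xmod, ('a \<Rightarrow> 'a) \<times> ('b \<Rightarrow> 'b)) cat" where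
  "XModGrp = full_subcat XMod (\<lambda>M. is_a_group (fibre M) (pcone (fibre M)))"


section \<open>The comparison functor\<close>

definition ker_d :: "('a, 'b) intcat \<Rightarrow> 'b rpogrp" where
  "ker_d X = rpo_kernel (ar X) (ob X) (dm X)"

definition to_xmod :: "('a, 'b) intcat \<Rightarrow> ('a, 'b) xmod" where
  "to_xmod X =
    \<lparr>base = ob X,
     fibre = ker_d X,
     act = (\<lambda>y\<in>carrier (ob X). \<lambda>x\<in>carrier (ker_d X).
              idt X y \<otimes>\<^bsub>ar X\<^esub> x \<otimes>\<^bsub>ar X\<^esub> inv\<^bsub>ar X\<^esub> (idt X y)),
     bdry = restrict (cd X) (carrier (ker_d X))\<rparr>"

definition to_xmod_arr ::
  "('a, 'b) intcat \<Rightarrow> ('a, 'b) intcat \<Rightarrow> ('a \<Rightarrow> 'a) \<times> ('b \<Rightarrow> 'b) \<Rightarrow>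
   ('a \<Rightarrow> 'a) \<times> ('b \<Rightarrow> 'b)" where
  "to_xmod_arr X Y = (\<lambda>(f0, f1). (f0, restrict f1 (carrier (ker_d X))))"

end

theory Submission
  imports Defs
begin

text \<open>
  In a Schreier internal category the composite \<open>cmp (a, b)\<close> is forced to be
  \<open>a \<otimes> inv (e (d a)) \<otimes> b\<close>, and \<open>ker d\<close> commutes elementwise with \<open>ker c\<close>. Since every \<open>a\<close>
  is \<open>k \<otimes> e (d a)\<close> with \<open>k \<in> ker d\<close>, positive whenever \<open>a\<close> is, everything is determined by its
  restriction to \<open>ker d\<close> and to the objects: this gives full faithfulness, and the semidirect
  product, re-encoded in the infinite universe, gives essential surjectivity. The only possible
  inversion is \<open>\<sigma> a = e (d a) \<otimes> inv a \<otimes> e (c a)\<close>. It is a homomorphism by the commutation of the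
  kernels, and it preserves the cone exactly when \<open>ker d \<inter> P\<close> is closed under inverses.
\<close>

section \<open>Equivalences from fully faithful, essentially surjective functors\<close>

text \<open>On the level of groups the argument is the classical one; the cones are the obstacle. An
  inverse of a positive element need not be positive, so in \<open>a = k \<otimes> e (d a)\<close> a
  positive \<open>a\<close> does not by itself give a positive \<open>k\<close>: that is the
  Schreier condition. It enters wherever a cone has to be checked without an inverse being
  available: for the action by conjugation, for extending a morphism from the kernel to all arrows,
  and in both directions of the groupoid criterion. There
  \<open>\<sigma> a = inv k \<otimes> e (c a)\<close>, whose second factor is positive for every
  positive \<open>a\<close>, so only \<open>inv k\<close> is in doubt. The composition formula comes
  from factoring the pair \<open>(a, b)\<close> as \<open>(k, \<one>)\<close> times
  \<open>(e (d a), b)\<close>: each factor is composed by a unit law. Essential surjectivity reaches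
  a crossed module only up to isomorphism, so the restriction to groupoids also needs the cone
  condition to be invariant under isomorphism.\<close>

lemma categoryD:
  assumes "category C"
  shows cat_Id: "\<And>X. X \<in> Obj C \<Longrightarrow> Id C X \<in> Hom C X X"
    and cat_Comp: "\<And>X Y Z f g. \<lbrakk>X \<in> Obj C; Y \<in> Obj C; Z \<in> Obj C; f \<in> Hom C X Y; g \<in> Hom C Y Z\<rbrakk>
      \<Longrightarrow> Comp C X Y Z g f \<in> Hom C X Z"
    and cat_right_Id: "\<And>X Y f. \<lbrakk>X \<in> Obj C; Y \<in> Obj C; f \<in> Hom C X Y\<rbrakk> \<Longrightarrow> Comp C X X Y f (Id C X) = f"
    and cat_left_Id: "\<And>X Y f. \<lbrakk>X \<in> Obj C; Y \<in> Obj C; f \<in> Hom C X Y\<rbrakk> \<Longrightarrow> Comp C X Y Y (Id C Y) f = f"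
    and cat_assoc: "\<And>W X Y Z f g h. \<lbrakk>W \<in> Obj C; X \<in> Obj C; Y \<in> Obj C; Z \<in> Obj C;
       f \<in> Hom C W X; g \<in> Hom C X Y; h \<in> Hom C Y Z\<rbrakk> \<Longrightarrow>
       Comp C W X Z (Comp C X Y Z h g) f = Comp C W Y Z h (Comp C W X Y g f)"
  using assms unfolding category_def by blast+

lemma cat_functorD:
  assumes "cat_functor C D F M"
  shows functor_Obj: "\<And>X. X \<in> Obj C \<Longrightarrow> F X \<in> Obj D"
    and functor_Hom: "\<And>X Y f. \<lbrakk>X \<in> Obj C; Y \<in> Obj C; f \<in> Hom C X Y\<rbrakk> \<Longrightarrow> M X Y f \<in> Hom D (F X) (F Y)"
    and functor_Id: "\<And>X. X \<in> Obj C \<Longrightarrow> M X X (Id C X) = Id D (F X)"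
    and functor_Comp: "\<And>X Y Z f g. \<lbrakk>X \<in> Obj C; Y \<in> Obj C; Z \<in> Obj C; f \<in> Hom C X Y; g \<in> Hom C Y Z\<rbrakk>
      \<Longrightarrow> M X Z (Comp C X Y Z g f) = Comp D (F X) (F Y) (F Z) (M Y Z g) (M X Y f)"
    and functor_dom_category: "category C" and functor_cod_category: "category D"
  using assms unfolding cat_functor_def by blast+

text \<open>Choice supplies an object \<open>G A\<close> with mutually inverse arrows
  \<open>u A\<close> and \<open>v A\<close> between \<open>F (G A)\<close> and \<open>A\<close>.
  Full faithfulness then lifts arrows of \<open>D\<close> back to \<open>C\<close>, and
  \<open>u\<close> becomes the counit.\<close>

lemma cat_equivalence_if_fully_faithful_ess_surj:
  assumes F: "cat_functor C D F M"
    and ff: "\<And>X Y. \<lbrakk>X \<in> Obj C; Y \<in> Obj C\<rbrakk> \<Longrightarrow> bij_betw (M X Y) (Hom C X Y) (Hom D (F X) (F Y))"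
    and eso: "\<And>A. A \<in> Obj D \<Longrightarrow> \<exists>X\<in>Obj C. \<exists>f. iso_arrow D (F X) A f"
  shows "cat_equivalence C D F M"
proof -
  note C = functor_dom_category[OF F] and D = functor_cod_category[OF F]
  have "\<forall>A\<in>Obj D. \<exists>X u v. X \<in> Obj C \<and> u \<in> Hom D (F X) A \<and> v \<in> Hom D A (F X) \<and>
      Comp D (F X) A (F X) v u = Id D (F X) \<and> Comp D A (F X) A u v = Id D A"
    using eso unfolding iso_arrow_def by blast
  then obtain G u v where G: "\<And>A. A \<in> Obj D \<Longrightarrow> G A \<in> Obj C"
    and u: "\<And>A. A \<in> Obj D \<Longrightarrow> u A \<in> Hom D (F (G A)) A"
    and v: "\<And>A. A \<in> Obj D \<Longrightarrow> v A \<in> Hom D A (F (G A))"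
    and vu: "\<And>A. A \<in> Obj D \<Longrightarrow> Comp D (F (G A)) A (F (G A)) (v A) (u A) = Id D (F (G A))"
    and uv: "\<And>A. A \<in> Obj D \<Longrightarrow> Comp D A (F (G A)) A (u A) (v A) = Id D A"
    by metis
  define L where "L X Y = inv_into (Hom C X Y) (M X Y)" for X Y
  have L: "L X Y h \<in> Hom C X Y" and M_L: "M X Y (L X Y h) = h"
    if "X \<in> Obj C" "Y \<in> Obj C" "h \<in> Hom D (F X) (F Y)" for X Y h
    using bij_betw_imp_surj_on[OF ff[OF that(1,2)]] that(3)
    unfolding L_def by (metis inv_into_into, metis f_inv_into_f)
  have faithful: "f = g"
    if "X \<in> Obj C" "Y \<in> Obj C" "f \<in> Hom C X Y" "g \<in> Hom C X Y" "M X Y f = M X Y g" for X Y f g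
    using bij_betw_imp_inj_on[OF ff[OF that(1,2)]] that(3-5) by (meson inj_onD)
  note FO = functor_Obj[OF F]
  note typing = G FO u v L functor_Hom[OF F] cat_Id[OF C] cat_Id[OF D] cat_Comp[OF C] cat_Comp[OF D]
  \<comment> \<open>The arrow \<open>g\<close> conjugated by the chosen isomorphisms. The
    quasi-inverse sends \<open>g\<close> to the lift of this arrow along \<open>M\<close>.\<close>
  define K where "K A B g = Comp D (F (G A)) B (F (G B)) (v B) (Comp D (F (G A)) A B g (u A))" for A B g
  have K: "K A B g \<in> Hom D (F (G A)) (F (G B))" if "A \<in> Obj D" "B \<in> Obj D" "g \<in> Hom D A B" for A B g
    unfolding K_def using that by (intro typing)
  \<comment> \<open>Naturality of \<open>u\<close>. Since each \<open>u B\<close> is monic, this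
    equation determines \<open>K A B g\<close>; compatibility with composition and naturality of the
    unit are both checked after composing with \<open>u\<close>.\<close>
  have uK: "Comp D (F (G A)) (F (G B)) B (u B) (K A B g) = Comp D (F (G A)) A B g (u A)"
    if "A \<in> Obj D" "B \<in> Obj D" "g \<in> Hom D A B" for A B g
  proof -
    have t: "Comp D (F (G A)) A B g (u A) \<in> Hom D (F (G A)) B"
      using that by (intro typing)
    have "Comp D (F (G A)) (F (G B)) B (u B) (K A B g) =
      Comp D (F (G A)) B B (Comp D B (F (G B)) B (u B) (v B)) (Comp D (F (G A)) A B g (u A))"
      unfolding K_def using that t by (subst cat_assoc[OF D]) (auto intro: typing)
    also have "\<dots> = Comp D (F (G A)) A B g (u A)"
      using that t by (simp add: uv cat_left_Id[OF D] FO G)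
    finally show ?thesis .
  qed
  have u_monic: "h = k" if "A \<in> Obj D" "W \<in> Obj D" "h \<in> Hom D W (F (G A))" "k \<in> Hom D W (F (G A))"
      "Comp D W (F (G A)) A (u A) h = Comp D W (F (G A)) A (u A) k" for A W h k
  proof -
    have "Comp D W A (F (G A)) (v A) (Comp D W (F (G A)) A (u A) h) = h" if "h \<in> Hom D W (F (G A))" for h
      using that \<open>A \<in> Obj D\<close> \<open>W \<in> Obj D\<close>
      by (simp add: cat_assoc[OF D, symmetric] cat_left_Id[OF D] u v vu FO G)
    from this[OF that(3)] this[OF that(4)] that(5) show ?thesis by metis
  qed
  define N where "N A B g = L (G A) (G B) (K A B g)" for A B g
  have N: "N A B g \<in> Hom C (G A) (G B)" and MN: "M (G A) (G B) (N A B g) = K A B g"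
    if "A \<in> Obj D" "B \<in> Obj D" "g \<in> Hom D A B" for A B g
    using that K L M_L G unfolding N_def by auto
  have K_Id: "K A A (Id D A) = Id D (F (G A))" if "A \<in> Obj D" for A
    unfolding K_def using that by (simp add: cat_left_Id[OF D] u FO G vu)
  have K_Comp: "K A E (Comp D A B E h g) = Comp D (F (G A)) (F (G B)) (F (G E)) (K B E h) (K A B g)"
    if o: "A \<in> Obj D" "B \<in> Obj D" "E \<in> Obj D" and g: "g \<in> Hom D A B" and h: "h \<in> Hom D B E" for A B E g h
  proof (rule u_monic[of E "F (G A)"])
    have "Comp D (F (G A)) (F (G E)) E (u E) (K A E (Comp D A B E h g)) =
        Comp D (F (G A)) A E (Comp D A B E h g) (u A)"
      using o g h by (simp add: uK cat_Comp[OF D])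
    also have "\<dots> = Comp D (F (G A)) B E h (Comp D (F (G A)) A B g (u A))"
      using o g h by (simp add: cat_assoc[OF D] FO G u)
    also have "\<dots> = Comp D (F (G A)) B E h (Comp D (F (G A)) (F (G B)) B (u B) (K A B g))"
      using o g h by (simp add: uK)
    also have "\<dots> = Comp D (F (G A)) (F (G B)) E (Comp D (F (G B)) B E h (u B)) (K A B g)"
      using o g h by (simp add: cat_assoc[OF D] FO G u K)
    also have "\<dots> = Comp D (F (G A)) (F (G B)) E
        (Comp D (F (G B)) (F (G E)) E (u E) (K B E h)) (K A B g)"
      using o g h by (simp add: uK)
    also have "\<dots> = Comp D (F (G A)) (F (G E)) E (u E)
       (Comp D (F (G A)) (F (G B)) (F (G E)) (K B E h) (K A B g))"
      using o g h by (simp add: cat_assoc[OF D] FO G u K)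
    finally show "Comp D (F (G A)) (F (G E)) E (u E) (K A E (Comp D A B E h g)) = \<dots>" .
  qed (use o g h in \<open>auto intro!: typing K\<close>)
  have GF: "cat_functor D C G N"
    unfolding cat_functor_def
  proof (intro conjI ballI)
    fix A assume A: "A \<in> Obj D"
    show "N A A (Id D A) = Id C (G A)"
      using A by (intro faithful[of "G A" "G A"])
        (auto intro: typing N simp: MN K_Id functor_Id[OF F] cat_Id[OF D] G)
  next
    fix A B E g h assume *: "A \<in> Obj D" "B \<in> Obj D" "E \<in> Obj D" "g \<in> Hom D A B" "h \<in> Hom D B E"
    show "N A E (Comp D A B E h g) = Comp C (G A) (G B) (G E) (N B E h) (N A B g)"
    proof (rule faithful[of "G A" "G E"])
      show "N A E (Comp D A B E h g) \<in> Hom C (G A) (G E)"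
        using * by (intro N cat_Comp[OF D])
      show "Comp C (G A) (G B) (G E) (N B E h) (N A B g) \<in> Hom C (G A) (G E)"
        using * by (intro N cat_Comp[OF C] G)
      show "M (G A) (G E) (N A E (Comp D A B E h g)) =
          M (G A) (G E) (Comp C (G A) (G B) (G E) (N B E h) (N A B g))"
        using * by (simp add: MN K_Comp functor_Comp[OF F] cat_Comp[OF D] G N)
    qed (use * G in auto)
  qed (use C D G N in auto)
  \<comment> \<open>The unit is the lift of \<open>v (F X)\<close>. Lifting \<open>u (F X)\<close>
    gives its inverse, because \<open>M\<close> is injective on hom-sets.\<close>
  define \<eta> where "\<eta> X = L X (G (F X)) (v (F X))" for X
  have \<eta>: "\<eta> X \<in> Hom C X (G (F X))" and M\<eta>: "M X (G (F X)) (\<eta> X) = v (F X)" if "X \<in> Obj C" for X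
    using that L M_L FO G v unfolding \<eta>_def by auto
  have id_functor: "cat_functor E E (\<lambda>X. X) (\<lambda>X Y f. f)" if "category E" for E :: "('e, 'f) cat"
    using that unfolding cat_functor_def by (auto intro: cat_Id cat_Comp)
  have GFF: "cat_functor C C (\<lambda>X. G (F X)) (\<lambda>X Y f. N (F X) (F Y) (M X Y f))"
    unfolding cat_functor_def using C
    by (auto intro: G FO N functor_Hom[OF F]
        simp: functor_Id[OF F] functor_Comp[OF F] functor_Id[OF GF] functor_Comp[OF GF] FO functor_Hom[OF F])
  have FGF: "cat_functor D D (\<lambda>A. F (G A)) (\<lambda>A B g. M (G A) (G B) (N A B g))"
    unfolding cat_functor_def using D
    by (auto intro: G FO N functor_Hom[OF F]
        simp: functor_Id[OF F] functor_Comp[OF F] functor_Id[OF GF] functor_Comp[OF GF] G N)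
  have "natural_iso C C (\<lambda>X. X) (\<lambda>X Y f. f) (\<lambda>X. G (F X)) (\<lambda>X Y f. N (F X) (F Y) (M X Y f)) \<eta>"
    unfolding natural_iso_def
  proof (intro conjI ballI id_functor C GFF)
    fix X assume X: "X \<in> Obj C"
    note o = X FO[OF X] G[OF FO[OF X]] FO[OF G[OF FO[OF X]]]
    let ?g = "L (G (F X)) X (u (F X))"
    have g: "?g \<in> Hom C (G (F X)) X" and Mg: "M (G (F X)) X ?g = u (F X)"
      using o L M_L u by auto
    have "Comp C X (G (F X)) X ?g (\<eta> X) = Id C X"
      by (rule faithful[OF X X])
        (use o g \<eta> in \<open>auto intro: typing simp: functor_Comp[OF F] functor_Id[OF F] M\<eta> Mg uv\<close>)
    moreover have "Comp C (G (F X)) X (G (F X)) (\<eta> X) ?g = Id C (G (F X))"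
      by (rule faithful[OF o(3) o(3)])
        (use o g \<eta> in \<open>auto intro: typing simp: functor_Comp[OF F] functor_Id[OF F] M\<eta> Mg vu\<close>)
    ultimately show "iso_arrow C X (G (F X)) (\<eta> X)"
      unfolding iso_arrow_def using \<eta> X g by blast
  next
    fix X Y f assume *: "X \<in> Obj C" "Y \<in> Obj C" "f \<in> Hom C X Y"
    note o = *(1,2) FO[OF *(1)] FO[OF *(2)] G[OF FO[OF *(1)]] G[OF FO[OF *(2)]]
      FO[OF G[OF FO[OF *(1)]]] FO[OF G[OF FO[OF *(2)]]]
    note Mf = functor_Hom[OF F *]
    show "Comp C X Y (G (F Y)) (\<eta> Y) f = Comp C X (G (F X)) (G (F Y)) (N (F X) (F Y) (M X Y f)) (\<eta> X)"
    proof (rule faithful[of X "G (F Y)"])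
      have "Comp D (F X) (F (G (F X))) (F (G (F Y))) (K (F X) (F Y) (M X Y f)) (v (F X)) =
         Comp D (F X) (F Y) (F (G (F Y))) (v (F Y)) (M X Y f)"
      proof (rule u_monic[of "F Y" "F X"])
        have "Comp D (F X) (F (G (F Y))) (F Y) (u (F Y))
            (Comp D (F X) (F (G (F X))) (F (G (F Y))) (K (F X) (F Y) (M X Y f)) (v (F X)))
           = Comp D (F X) (F (G (F X))) (F Y) (Comp D (F (G (F X))) (F (G (F Y))) (F Y) (u (F Y))
             (K (F X) (F Y) (M X Y f))) (v (F X))"
          using o Mf by (simp add: cat_assoc[OF D] u v K)
        also have "\<dots> = Comp D (F X) (F X) (F Y) (M X Y f) (Comp D (F X) (F (G (F X))) (F X) (u (F X)) (v (F X)))"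
          using o Mf by (simp add: uK cat_assoc[OF D] u v)
        also have "\<dots> = M X Y f"
          using o Mf by (simp add: uv cat_right_Id[OF D])
        also have "\<dots> = Comp D (F X) (F Y) (F Y) (Comp D (F Y) (F (G (F Y))) (F Y) (u (F Y)) (v (F Y))) (M X Y f)"
          using o Mf by (simp add: uv cat_left_Id[OF D])
        also have "\<dots> = Comp D (F X) (F (G (F Y))) (F Y) (u (F Y)) (Comp D (F X) (F Y) (F (G (F Y))) (v (F Y)) (M X Y f))"
          using o Mf by (simp add: cat_assoc[OF D] u v)
        finally show "Comp D (F X) (F (G (F Y))) (F Y) (u (F Y))
            (Comp D (F X) (F (G (F X))) (F (G (F Y))) (K (F X) (F Y) (M X Y f)) (v (F X))) = \<dots>" .
      qed (use o Mf in \<open>auto intro!: cat_Comp[OF D] K u v\<close>)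
      then show "M X (G (F Y)) (Comp C X Y (G (F Y)) (\<eta> Y) f) =
          M X (G (F Y)) (Comp C X (G (F X)) (G (F Y)) (N (F X) (F Y) (M X Y f)) (\<eta> X))"
        using * o Mf by (simp add: functor_Comp[OF F] \<eta> M\<eta> N MN)
    qed (use * o Mf in \<open>auto intro!: cat_Comp[OF C] \<eta> N\<close>)
  qed
  moreover have "natural_iso D D (\<lambda>A. F (G A)) (\<lambda>A B g. M (G A) (G B) (N A B g)) (\<lambda>A. A) (\<lambda>A B g. g) u"
    unfolding natural_iso_def
  proof (intro conjI ballI id_functor D FGF)
    show "iso_arrow D (F (G A)) A (u A)" if "A \<in> Obj D" for A
      unfolding iso_arrow_def using that u v uv vu by blast
  qed (simp add: MN uK)
  ultimately show ?thesis
    unfolding cat_equivalence_def using F GF by blast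
qed

section \<open>Restriction of an equivalence to full subcategories\<close>

lemma full_subcat_simps [simp]:
  "Obj (full_subcat C S) = {X \<in> Obj C. S X}"
  "Hom (full_subcat C S) = Hom C"
  "Id (full_subcat C S) = Id C"
  "Comp (full_subcat C S) = Comp C"
  by (simp_all add: full_subcat_def)

lemma iso_arrow_full_subcat [simp]: "iso_arrow (full_subcat C S) = iso_arrow C"
  by (simp add: iso_arrow_def fun_eq_iff)

lemma category_full_subcat: "category C \<Longrightarrow> category (full_subcat C S)"
  unfolding category_def by simp

lemma cat_functor_full_subcat:
  assumes "cat_functor C D F M" "\<And>X. X \<in> Obj C \<Longrightarrow> S X \<Longrightarrow> T (F X)"
  shows "cat_functor (full_subcat C S) (full_subcat D T) F M"
  using assms unfolding cat_functor_def by (simp add: category_full_subcat)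

text \<open>Hom-sets are those of the large categories, so only essential surjectivity needs an
  argument: if \<open>F X\<close> is isomorphic to \<open>A\<close> and \<open>T A\<close> holds,
  invariance of \<open>T\<close> gives \<open>T (F X)\<close>, hence \<open>S X\<close>.\<close>

lemma cat_equivalence_full_subcat:
  assumes F: "cat_functor C D F M"
    and ff: "\<And>X Y. \<lbrakk>X \<in> Obj C; Y \<in> Obj C\<rbrakk> \<Longrightarrow> bij_betw (M X Y) (Hom C X Y) (Hom D (F X) (F Y))"
    and eso: "\<And>A. A \<in> Obj D \<Longrightarrow> \<exists>X\<in>Obj C. \<exists>f. iso_arrow D (F X) A f"
    and ST: "\<And>X. X \<in> Obj C \<Longrightarrow> S X \<longleftrightarrow> T (F X)"
    and T_iso: "\<And>A B f. \<lbrakk>A \<in> Obj D; B \<in> Obj D; iso_arrow D A B f; T B\<rbrakk> \<Longrightarrow> T A"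
  shows "cat_equivalence (full_subcat C S) (full_subcat D T) F M"
proof (rule cat_equivalence_if_fully_faithful_ess_surj)
  fix A assume A: "A \<in> Obj (full_subcat D T)"
  then obtain X f where "X \<in> Obj C" "iso_arrow D (F X) A f"
    using eso[of A] by auto
  then show "\<exists>X\<in>Obj (full_subcat C S). \<exists>f. iso_arrow (full_subcat D T) (F X) A f"
    using A ST T_iso functor_Obj[OF F] by (auto intro!: bexI[of _ X])
qed (use F ff ST in \<open>auto intro: cat_functor_full_subcat\<close>)

section \<open>Groups and cones\<close>

text \<open>Once words are bracketed to the right, a letter and its inverse may be followed by
  further letters; these are the cancellation rules for that case. \<open>word_simps\<close> uses
  them for free reduction.\<close>

lemma (in group) mult_inv_cancel:
  assumes "x \<in> carrier G" "y \<in> carrier G"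
  shows "x \<otimes> (inv x \<otimes> y) = y" "inv x \<otimes> (x \<otimes> y) = y"
  using assms by (simp_all flip: m_assoc)

lemmas (in group) word_simps = m_assoc inv_mult_group mult_inv_cancel

lemma rpogroupD:
  assumes "rpogroup G"
  shows "group G" "pcone G \<subseteq> carrier G" "\<one>\<^bsub>G\<^esub> \<in> pcone G"
    "\<And>x y. \<lbrakk>x \<in> pcone G; y \<in> pcone G\<rbrakk> \<Longrightarrow> x \<otimes>\<^bsub>G\<^esub> y \<in> pcone G"
  using assms unfolding rpogroup_def submonoid_def by auto

lemma rpo_homI:
  assumes "\<And>x. x \<in> carrier G \<Longrightarrow> f x \<in> carrier H"
    and "\<And>x y. \<lbrakk>x \<in> carrier G; y \<in> carrier G\<rbrakk> \<Longrightarrow> f (x \<otimes>\<^bsub>G\<^esub> y) = f x \<otimes>\<^bsub>H\<^esub> f y"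
    and "f \<in> extensional (carrier G)"
    and "\<And>x. x \<in> pcone G \<Longrightarrow> f x \<in> pcone H"
  shows "f \<in> rpo_hom G H"
  using assms unfolding rpo_hom_def hom_def by auto

lemma rpo_homD:
  assumes "f \<in> rpo_hom G H"
  shows rpo_hom_hom: "f \<in> hom G H"
    and rpo_hom_closed: "\<And>x. x \<in> carrier G \<Longrightarrow> f x \<in> carrier H"
    and rpo_hom_mult: "\<And>x y. \<lbrakk>x \<in> carrier G; y \<in> carrier G\<rbrakk> \<Longrightarrow> f (x \<otimes>\<^bsub>G\<^esub> y) = f x \<otimes>\<^bsub>H\<^esub> f y"
    and rpo_hom_ext: "f \<in> extensional (carrier G)"
    and rpo_hom_pcone: "\<And>x. x \<in> pcone G \<Longrightarrow> f x \<in> pcone H"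
  using assms unfolding rpo_hom_def hom_def by auto

lemma rpo_hom_compose:
  assumes "rpogroup G" "f \<in> rpo_hom G H" "g \<in> rpo_hom H K"
  shows "compose (carrier G) g f \<in> rpo_hom G K"
proof (rule rpo_homI)
  interpret group G by (rule rpogroupD(1)[OF assms(1)])
  show "compose (carrier G) g f (x \<otimes>\<^bsub>G\<^esub> y) = compose (carrier G) g f x \<otimes>\<^bsub>K\<^esub> compose (carrier G) g f y"
    if "x \<in> carrier G" "y \<in> carrier G" for x y
    using that rpo_homD[OF assms(2)] rpo_homD[OF assms(3)] by (simp add: compose_def)
qed (use rpo_homD[OF assms(2)] rpo_homD[OF assms(3)] rpogroupD(2)[OF assms(1)] in
      \<open>auto simp: compose_def\<close>)

lemma rpo_hom_id: "rpogroup G \<Longrightarrow> (\<lambda>x\<in>carrier G. x) \<in> rpo_hom G G"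
  using rpogroupD by (intro rpo_homI) (auto simp: group.is_monoid monoid.m_closed)

lemma rpo_hom_extensional_eq:
  assumes "f \<in> rpo_hom G H" "g \<in> rpo_hom G H" "\<And>x. x \<in> carrier G \<Longrightarrow> f x = g x"
  shows "f = g"
  using assms by (meson extensionalityI rpo_hom_ext)

lemma group_hom_rpo_hom: "rpogroup G \<Longrightarrow> rpogroup H \<Longrightarrow> f \<in> rpo_hom G H \<Longrightarrow> group_hom G H f"
  by (simp add: group_hom_def group_hom_axioms_def rpogroupD(1) rpo_hom_hom)

lemma rpo_Aut_simps:
  "carrier (rpo_Aut K) = hom K K \<inter> Bij (carrier K)"
  "pcone (rpo_Aut K) = {f \<in> hom K K \<inter> Bij (carrier K). f ` pcone K \<subseteq> pcone K}"
  "\<one>\<^bsub>rpo_Aut K\<^esub> = (\<lambda>x\<in>carrier K. x)"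
  by (simp_all add: rpo_Aut_def AutoGroup_def auto_def BijGroup_def)

lemma rpo_Aut_mult:
  "f \<in> Bij (carrier K) \<Longrightarrow> g \<in> Bij (carrier K) \<Longrightarrow> f \<otimes>\<^bsub>rpo_Aut K\<^esub> g = compose (carrier K) f g"
  by (simp add: rpo_Aut_def AutoGroup_def BijGroup_def)

text \<open>\<open>rpo_Aut K\<close> and \<open>AutoGroup K\<close> share carrier, product and unit,
  and the group axioms do not see the additional cone.\<close>

lemma group_rpo_Aut:
  assumes "group K"
  shows "group (rpo_Aut K)"
proof -
  have "group (AutoGroup K)" using assms by (rule group.AutoGroup)
  then show ?thesis
    unfolding rpo_Aut_def group_def monoid_def group_axioms_def Units_def by simp
qed

section \<open>Crossed modules\<close>

locale crossed_mod =
  fixes M :: "('a, 'b) xmod"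
  assumes crossed: "crossed_module M"
begin

lemma rpogroup_base: "rpogroup (base M)" and rpogroup_fibre: "rpogroup (fibre M)"
  and bdry_hom: "bdry M \<in> rpo_hom (fibre M) (base M)"
  and act_hom: "act M \<in> rpo_hom (base M) (rpo_Aut (fibre M))"
  using crossed unfolding crossed_module_def by auto

lemma bdry_act: "\<lbrakk>x \<in> carrier (base M); a \<in> carrier (fibre M)\<rbrakk> \<Longrightarrow>
    bdry M (act M x a) = x \<otimes>\<^bsub>base M\<^esub> bdry M a \<otimes>\<^bsub>base M\<^esub> inv\<^bsub>base M\<^esub> x"
  and act_bdry: "\<lbrakk>a \<in> carrier (fibre M); b \<in> carrier (fibre M)\<rbrakk> \<Longrightarrow>
    act M (bdry M a) b = a \<otimes>\<^bsub>fibre M\<^esub> b \<otimes>\<^bsub>fibre M\<^esub> inv\<^bsub>fibre M\<^esub> a"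
  using crossed unfolding crossed_module_def by auto

sublocale base: group "base M" by (rule rpogroupD(1)[OF rpogroup_base])
sublocale fibre: group "fibre M" by (rule rpogroupD(1)[OF rpogroup_fibre])
sublocale bdry: group_hom "fibre M" "base M" "bdry M"
  by (rule group_hom_rpo_hom[OF rpogroup_fibre rpogroup_base bdry_hom])

lemma act_auto: "x \<in> carrier (base M) \<Longrightarrow> act M x \<in> hom (fibre M) (fibre M) \<inter> Bij (carrier (fibre M))"
  using rpo_hom_closed[OF act_hom] by (simp add: rpo_Aut_simps)

lemma act_closed [simp]: "\<lbrakk>x \<in> carrier (base M); a \<in> carrier (fibre M)\<rbrakk> \<Longrightarrow> act M x a \<in> carrier (fibre M)"
  and act_mult [simp]: "\<lbrakk>x \<in> carrier (base M); a \<in> carrier (fibre M); b \<in> carrier (fibre M)\<rbrakk> \<Longrightarrow>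
     act M x (a \<otimes>\<^bsub>fibre M\<^esub> b) = act M x a \<otimes>\<^bsub>fibre M\<^esub> act M x b"
  using act_auto[of x] by (auto simp: hom_def)

lemma act_act: "\<lbrakk>x \<in> carrier (base M); y \<in> carrier (base M); a \<in> carrier (fibre M)\<rbrakk> \<Longrightarrow>
     act M (x \<otimes>\<^bsub>base M\<^esub> y) a = act M x (act M y a)"
  using act_auto[of x] act_auto[of y] by (simp add: rpo_hom_mult[OF act_hom] rpo_Aut_mult compose_def)

lemma act_one [simp]: "a \<in> carrier (fibre M) \<Longrightarrow> act M \<one>\<^bsub>base M\<^esub> a = a"
  using hom_one[OF rpo_hom_hom[OF act_hom] base.group_axioms group_rpo_Aut[OF fibre.group_axioms]]
  by (simp add: rpo_Aut_simps)

lemma act_fibre_one [simp]: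
  assumes "x \<in> carrier (base M)" shows "act M x \<one>\<^bsub>fibre M\<^esub> = \<one>\<^bsub>fibre M\<^esub>"
  using act_auto[OF assms] by (auto intro: hom_one fibre.group_axioms)

lemma act_pcone: "\<lbrakk>x \<in> pcone (base M); a \<in> pcone (fibre M)\<rbrakk> \<Longrightarrow> act M x a \<in> pcone (fibre M)"
  using rpo_hom_pcone[OF act_hom] by (auto simp: rpo_Aut_simps)

end

text \<open>Bijectivity of each \<open>act M x\<close> is absent from the premises: an action by
  endomorphisms is one by automorphisms, as \<open>inv x\<close> acts as the inverse of
  \<open>x\<close>.\<close>

lemma crossed_moduleI:
  fixes M :: "('a, 'b) xmod"
  assumes "rpogroup (base M)" "rpogroup (fibre M)" "bdry M \<in> rpo_hom (fibre M) (base M)"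
    and ext: "act M \<in> extensional (carrier (base M))"
      "\<And>x. x \<in> carrier (base M) \<Longrightarrow> act M x \<in> extensional (carrier (fibre M))"
    and closed: "\<And>x a. \<lbrakk>x \<in> carrier (base M); a \<in> carrier (fibre M)\<rbrakk> \<Longrightarrow> act M x a \<in> carrier (fibre M)"
    and mult: "\<And>x a b. \<lbrakk>x \<in> carrier (base M); a \<in> carrier (fibre M); b \<in> carrier (fibre M)\<rbrakk> \<Longrightarrow>
      act M x (a \<otimes>\<^bsub>fibre M\<^esub> b) = act M x a \<otimes>\<^bsub>fibre M\<^esub> act M x b"
    and act: "\<And>x y a. \<lbrakk>x \<in> carrier (base M); y \<in> carrier (base M); a \<in> carrier (fibre M)\<rbrakk> \<Longrightarrow>
      act M (x \<otimes>\<^bsub>base M\<^esub> y) a = act M x (act M y a)"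
    and one: "\<And>a. a \<in> carrier (fibre M) \<Longrightarrow> act M \<one>\<^bsub>base M\<^esub> a = a"
    and pcone: "\<And>x a. \<lbrakk>x \<in> pcone (base M); a \<in> pcone (fibre M)\<rbrakk> \<Longrightarrow> act M x a \<in> pcone (fibre M)"
    and peiffer: "\<And>x a. \<lbrakk>x \<in> carrier (base M); a \<in> carrier (fibre M)\<rbrakk> \<Longrightarrow>
      bdry M (act M x a) = x \<otimes>\<^bsub>base M\<^esub> bdry M a \<otimes>\<^bsub>base M\<^esub> inv\<^bsub>base M\<^esub> x"
      "\<And>a b. \<lbrakk>a \<in> carrier (fibre M); b \<in> carrier (fibre M)\<rbrakk> \<Longrightarrow>
      act M (bdry M a) b = a \<otimes>\<^bsub>fibre M\<^esub> b \<otimes>\<^bsub>fibre M\<^esub> inv\<^bsub>fibre M\<^esub> a"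
  shows "crossed_module M"
proof -
  interpret base: group "base M" by (rule rpogroupD(1)[OF assms(1)])
  have aut: "act M x \<in> hom (fibre M) (fibre M) \<inter> Bij (carrier (fibre M))" if x: "x \<in> carrier (base M)" for x
  proof
    show "act M x \<in> hom (fibre M) (fibre M)"
      using x closed mult by (auto simp: hom_def)
    have "bij_betw (act M x) (carrier (fibre M)) (carrier (fibre M))"
      by (rule bij_betw_byWitness[where f' = "act M (inv\<^bsub>base M\<^esub> x)"])
        (use x closed one in \<open>auto simp flip: act\<close>)
    then show "act M x \<in> Bij (carrier (fibre M))"
      using ext x by (simp add: Bij_def)
  qed
  have "act M \<in> rpo_hom (base M) (rpo_Aut (fibre M))"
  proof (rule rpo_homI)
    fix x y assume xy: "x \<in> carrier (base M)" "y \<in> carrier (base M)"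
    show "act M (x \<otimes>\<^bsub>base M\<^esub> y) = act M x \<otimes>\<^bsub>rpo_Aut (fibre M)\<^esub> act M y"
    proof (rule extensionalityI)
      show "act M (x \<otimes>\<^bsub>base M\<^esub> y) \<in> extensional (carrier (fibre M))"
        using xy ext by auto
    qed (use xy aut act in \<open>auto simp: rpo_Aut_mult compose_def\<close>)
  qed (use aut ext pcone rpogroupD(2)[OF assms(1)] in \<open>auto simp: rpo_Aut_simps\<close>)
  then show ?thesis
    unfolding crossed_module_def by (intro conjI ballI assms(1-3) peiffer)
qed

text \<open>\<open>inv\<close> is a definite description over the carrier, so after shrinking the
  carrier to the kernel it has to be identified again, through uniqueness of inverses.\<close>

lemma rpogroup_rpo_kernel:
  assumes G: "rpogroup G" and H: "rpogroup H" and f: "f \<in> rpo_hom G H"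
  shows "rpogroup (rpo_kernel G H f)"
    and inv_rpo_kernel: "x \<in> kernel G H f \<Longrightarrow> inv\<^bsub>rpo_kernel G H f\<^esub> x = inv\<^bsub>G\<^esub> x"
proof -
  interpret f: group_hom G H f by (rule group_hom_rpo_hom[OF assms])
  have "group (G\<lparr>carrier := kernel G H f\<rparr>)"
    using f.subgroup_kernel f.G.group_axioms by (rule subgroup.subgroup_is_group)
  then have K: "group (rpo_kernel G H f)"
    unfolding rpo_kernel_def group_def monoid_def group_axioms_def Units_def by simp
  then show "rpogroup (rpo_kernel G H f)"
    using rpogroupD[OF G] unfolding rpogroup_def
    by (auto simp: rpo_kernel_def submonoid_def kernel_def)
  show "inv\<^bsub>rpo_kernel G H f\<^esub> x = inv\<^bsub>G\<^esub> x" if "x \<in> kernel G H f"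
    using that by (intro group.inv_equality[OF K]) (auto simp: rpo_kernel_def kernel_def)
qed

section \<open>Schreier internal categories\<close>

lemma composable_simps:
  "carrier (composable X) = {(a, b). a \<in> carrier (ar X) \<and> b \<in> carrier (ar X) \<and> dm X a = cd X b}"
  "pcone (composable X) = {(a, b). a \<in> pcone (ar X) \<and> b \<in> pcone (ar X) \<and> dm X a = cd X b}"
  "(a, b) \<otimes>\<^bsub>composable X\<^esub> (a', b') = (a \<otimes>\<^bsub>ar X\<^esub> a', b \<otimes>\<^bsub>ar X\<^esub> b')"
  by (auto simp: composable_def rpo_pullback_def)

locale schreier_cat =
  fixes X :: "('a, 'b) intcat"
  assumes schreier: "schreier_category X"
begin

lemma internal: "internal_category X"
  using schreier unfolding schreier_category_def by simp

lemma rpogroup_ob: "rpogroup (ob X)" and rpogroup_ar: "rpogroup (ar X)"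
  and dm_hom: "dm X \<in> rpo_hom (ar X) (ob X)" and cd_hom: "cd X \<in> rpo_hom (ar X) (ob X)"
  and idt_hom: "idt X \<in> rpo_hom (ob X) (ar X)"
  and cmp_hom: "cmp X \<in> rpo_hom (composable X) (ar X)"
  and cmp_idt_left: "\<And>a. a \<in> carrier (ar X) \<Longrightarrow> cmp X (idt X (cd X a), a) = a"
  and cmp_idt_right: "\<And>a. a \<in> carrier (ar X) \<Longrightarrow> cmp X (a, idt X (dm X a)) = a"
  using internal unfolding internal_category_def by auto

lemma dm_idt [simp]: "x \<in> carrier (ob X) \<Longrightarrow> dm X (idt X x) = x"
  and cd_idt [simp]: "x \<in> carrier (ob X) \<Longrightarrow> cd X (idt X x) = x"
  using internal unfolding internal_category_def by auto

sublocale ob: group "ob X" by (rule rpogroupD(1)[OF rpogroup_ob])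
sublocale ar: group "ar X" by (rule rpogroupD(1)[OF rpogroup_ar])
sublocale dm: group_hom "ar X" "ob X" "dm X"
  by (rule group_hom_rpo_hom[OF rpogroup_ar rpogroup_ob dm_hom])
sublocale cd: group_hom "ar X" "ob X" "cd X"
  by (rule group_hom_rpo_hom[OF rpogroup_ar rpogroup_ob cd_hom])
sublocale idt: group_hom "ob X" "ar X" "idt X"
  by (rule group_hom_rpo_hom[OF rpogroup_ob rpogroup_ar idt_hom])

lemma pcone_ker_part: "a \<in> pcone (ar X) \<Longrightarrow> a \<otimes>\<^bsub>ar X\<^esub> inv\<^bsub>ar X\<^esub> idt X (dm X a) \<in> pcone (ar X)"
  using schreier unfolding schreier_category_def schreier_split_epi_def by simp

lemma cmp_interchange:
  "\<lbrakk>a \<in> carrier (ar X); b \<in> carrier (ar X); dm X a = cd X b;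
    a' \<in> carrier (ar X); b' \<in> carrier (ar X); dm X a' = cd X b'\<rbrakk> \<Longrightarrow>
   cmp X (a \<otimes>\<^bsub>ar X\<^esub> a', b \<otimes>\<^bsub>ar X\<^esub> b') = cmp X (a, b) \<otimes>\<^bsub>ar X\<^esub> cmp X (a', b')"
  using rpo_hom_mult[OF cmp_hom, of "(a, b)" "(a', b')"] by (simp add: composable_simps)

lemma cmp_eq:
  assumes a: "a \<in> carrier (ar X)" and b: "b \<in> carrier (ar X)" and ab: "dm X a = cd X b"
  shows "cmp X (a, b) = a \<otimes>\<^bsub>ar X\<^esub> inv\<^bsub>ar X\<^esub> idt X (dm X a) \<otimes>\<^bsub>ar X\<^esub> b"
proof -
  let ?e = "idt X (dm X a)" and ?k = "a \<otimes>\<^bsub>ar X\<^esub> inv\<^bsub>ar X\<^esub> idt X (dm X a)"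
  \<comment> \<open>Both factors are composable pairs with an identity arrow in them:
    \<open>\<one>\<close> is the identity of \<open>dm X ?k = \<one>\<close>, and \<open>?e\<close>
    is the identity of \<open>cd X b\<close>. Interchange therefore splits the composite into two
    unit laws.\<close>
  have "(a, b) = (?k \<otimes>\<^bsub>ar X\<^esub> ?e, \<one>\<^bsub>ar X\<^esub> \<otimes>\<^bsub>ar X\<^esub> b)"
    using a b by (simp add: ar.m_assoc)
  then have "cmp X (a, b) = cmp X (?k, \<one>\<^bsub>ar X\<^esub>) \<otimes>\<^bsub>ar X\<^esub> cmp X (?e, b)"
    using a b ab by (simp only:) (subst cmp_interchange; simp)
  moreover have "cmp X (?k, \<one>\<^bsub>ar X\<^esub>) = ?k"
    using cmp_idt_right[of ?k] a by simp
  moreover have "cmp X (?e, b) = b"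
    using cmp_idt_left[OF b] ab by simp
  ultimately show ?thesis by simp
qed

text \<open>Eckmann--Hilton: both products are \<open>cmp X (k, z)\<close>.\<close>

lemma ker_dm_commutes_ker_cd:
  assumes k: "k \<in> carrier (ar X)" "dm X k = \<one>\<^bsub>ob X\<^esub>" and z: "z \<in> carrier (ar X)" "cd X z = \<one>\<^bsub>ob X\<^esub>"
  shows "k \<otimes>\<^bsub>ar X\<^esub> z = z \<otimes>\<^bsub>ar X\<^esub> k"
  using cmp_interchange[of k "\<one>\<^bsub>ar X\<^esub>" "\<one>\<^bsub>ar X\<^esub>" z] cmp_interchange[of "\<one>\<^bsub>ar X\<^esub>" z k "\<one>\<^bsub>ar X\<^esub>"] k z
  by (simp add: cmp_eq)

section \<open>The crossed module of a Schreier internal category\<close>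

lemma ker_d_simps:
  "carrier (ker_d X) = {a \<in> carrier (ar X). dm X a = \<one>\<^bsub>ob X\<^esub>}"
  "pcone (ker_d X) = {a \<in> pcone (ar X). dm X a = \<one>\<^bsub>ob X\<^esub>}"
  "a \<otimes>\<^bsub>ker_d X\<^esub> b = a \<otimes>\<^bsub>ar X\<^esub> b"
  "\<one>\<^bsub>ker_d X\<^esub> = \<one>\<^bsub>ar X\<^esub>"
  using rpogroupD(2)[OF rpogroup_ar] by (auto simp: ker_d_def rpo_kernel_def kernel_def)

lemma rpogroup_ker_d: "rpogroup (ker_d X)"
  unfolding ker_d_def by (rule rpogroup_rpo_kernel[OF rpogroup_ar rpogroup_ob dm_hom])

lemma inv_ker_d: "a \<in> carrier (ar X) \<Longrightarrow> dm X a = \<one>\<^bsub>ob X\<^esub> \<Longrightarrow> inv\<^bsub>ker_d X\<^esub> a = inv\<^bsub>ar X\<^esub> a"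
  unfolding ker_d_def by (rule inv_rpo_kernel[OF rpogroup_ar rpogroup_ob dm_hom]) (simp add: kernel_def)

lemma ker_part:
  "a \<in> carrier (ar X) \<Longrightarrow> a \<otimes>\<^bsub>ar X\<^esub> inv\<^bsub>ar X\<^esub> idt X (dm X a) \<in> carrier (ker_d X)"
  by (simp add: ker_d_simps)

text \<open>The Peiffer identity. The element \<open>inv a \<otimes> idt X (cd X a)\<close> is
  killed by \<open>cd X\<close>, so it commutes with \<open>b\<close>, which lies in the kernel of
  \<open>dm X\<close>; hence \<open>a\<close> and \<open>idt X (cd X a)\<close> conjugate
  \<open>b\<close> to the same element.\<close>

lemma conj_bdry:
  assumes a: "a \<in> carrier (ker_d X)" and b: "b \<in> carrier (ker_d X)"
  shows "idt X (cd X a) \<otimes>\<^bsub>ar X\<^esub> b \<otimes>\<^bsub>ar X\<^esub> inv\<^bsub>ar X\<^esub> idt X (cd X a) = a \<otimes>\<^bsub>ar X\<^esub> b \<otimes>\<^bsub>ar X\<^esub> inv\<^bsub>ar X\<^esub> a"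
proof -
  let ?e = "idt X (cd X a)"
  have ab: "a \<in> carrier (ar X)" "b \<in> carrier (ar X)" "dm X a = \<one>\<^bsub>ob X\<^esub>" "dm X b = \<one>\<^bsub>ob X\<^esub>"
    using a b by (auto simp: ker_d_simps)
  have "a \<otimes>\<^bsub>ar X\<^esub> b \<otimes>\<^bsub>ar X\<^esub> inv\<^bsub>ar X\<^esub> a = a \<otimes>\<^bsub>ar X\<^esub> (b \<otimes>\<^bsub>ar X\<^esub> (inv\<^bsub>ar X\<^esub> a \<otimes>\<^bsub>ar X\<^esub> ?e)) \<otimes>\<^bsub>ar X\<^esub> inv\<^bsub>ar X\<^esub> ?e"
    using ab by (simp add: ar.word_simps del: idt.hom_inv)
  also have "b \<otimes>\<^bsub>ar X\<^esub> (inv\<^bsub>ar X\<^esub> a \<otimes>\<^bsub>ar X\<^esub> ?e) = inv\<^bsub>ar X\<^esub> a \<otimes>\<^bsub>ar X\<^esub> ?e \<otimes>\<^bsub>ar X\<^esub> b"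
    using ab by (intro ker_dm_commutes_ker_cd) auto
  also have "a \<otimes>\<^bsub>ar X\<^esub> (inv\<^bsub>ar X\<^esub> a \<otimes>\<^bsub>ar X\<^esub> ?e \<otimes>\<^bsub>ar X\<^esub> b) \<otimes>\<^bsub>ar X\<^esub> inv\<^bsub>ar X\<^esub> ?e = ?e \<otimes>\<^bsub>ar X\<^esub> b \<otimes>\<^bsub>ar X\<^esub> inv\<^bsub>ar X\<^esub> ?e"
    using ab by (simp add: ar.word_simps)
  finally show ?thesis by simp
qed

lemma to_xmod_simps:
  "base (to_xmod X) = ob X"
  "fibre (to_xmod X) = ker_d X"
  "a \<in> carrier (ker_d X) \<Longrightarrow> bdry (to_xmod X) a = cd X a"
  "\<lbrakk>y \<in> carrier (ob X); a \<in> carrier (ker_d X)\<rbrakk> \<Longrightarrow>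
    act (to_xmod X) y a = idt X y \<otimes>\<^bsub>ar X\<^esub> a \<otimes>\<^bsub>ar X\<^esub> inv\<^bsub>ar X\<^esub> idt X y"
  by (simp_all add: to_xmod_def)

lemma crossed_module_to_xmod: "crossed_module (to_xmod X)"
proof (rule crossed_moduleI, unfold to_xmod_simps(1,2))
  show "bdry (to_xmod X) \<in> rpo_hom (ker_d X) (ob X)"
    using rpo_hom_pcone[OF cd_hom] rpogroupD(2)[OF rpogroup_ar]
    by (intro rpo_homI) (auto simp: to_xmod_def ker_d_simps)
next
  fix x a assume *: "x \<in> pcone (ob X)" "a \<in> pcone (ker_d X)"
  then have c: "x \<in> carrier (ob X)" "a \<in> carrier (ar X)" "dm X a = \<one>\<^bsub>ob X\<^esub>"
    using rpogroupD(2)[OF rpogroup_ob] rpogroupD(2)[OF rpogroup_ar] by (auto simp: ker_d_simps)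
  \<comment> \<open>The factor \<open>inv (idt X x)\<close> of the conjugate need not be positive.
    But \<open>idt X x \<otimes> a\<close> is positive with domain \<open>x\<close>, so the
    conjugate is its kernel part and the Schreier condition applies.\<close>
  have "idt X x \<otimes>\<^bsub>ar X\<^esub> a \<in> pcone (ar X)"
    using * rpo_hom_pcone[OF idt_hom] rpogroupD(4)[OF rpogroup_ar] by (auto simp: ker_d_simps)
  from pcone_ker_part[OF this] show "act (to_xmod X) x a \<in> pcone (ker_d X)"
    using * c by (simp add: to_xmod_simps ker_d_simps)
next
  fix a b assume *: "a \<in> carrier (ker_d X)" "b \<in> carrier (ker_d X)"
  then show "act (to_xmod X) (bdry (to_xmod X) a) b = a \<otimes>\<^bsub>ker_d X\<^esub> b \<otimes>\<^bsub>ker_d X\<^esub> inv\<^bsub>ker_d X\<^esub> a"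
    using conj_bdry[OF *] by (simp add: to_xmod_simps ker_d_simps inv_ker_d)
next
  fix x a b assume "x \<in> carrier (ob X)" "a \<in> carrier (ker_d X)" "b \<in> carrier (ker_d X)"
  then show "act (to_xmod X) x (a \<otimes>\<^bsub>ker_d X\<^esub> b) = act (to_xmod X) x a \<otimes>\<^bsub>ker_d X\<^esub> act (to_xmod X) x b"
    by (simp add: to_xmod_simps ker_d_simps ar.word_simps del: idt.hom_inv)
next
  fix x y a assume "x \<in> carrier (ob X)" "y \<in> carrier (ob X)" "a \<in> carrier (ker_d X)"
  then show "act (to_xmod X) (x \<otimes>\<^bsub>ob X\<^esub> y) a = act (to_xmod X) x (act (to_xmod X) y a)"
    by (simp add: to_xmod_simps ker_d_simps ar.word_simps del: idt.hom_inv)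
next
  fix x a assume "x \<in> carrier (ob X)" "a \<in> carrier (ker_d X)"
  then show "bdry (to_xmod X) (act (to_xmod X) x a) = x \<otimes>\<^bsub>ob X\<^esub> bdry (to_xmod X) a \<otimes>\<^bsub>ob X\<^esub> inv\<^bsub>ob X\<^esub> x"
    by (simp add: to_xmod_simps ker_d_simps)
qed (simp_all add: rpogroup_ob rpogroup_ker_d to_xmod_def ker_d_simps)

section \<open>Inverses for composition and the cone of the kernel\<close>

lemma internal_groupoid_iff:
  "internal_groupoid X \<longleftrightarrow> is_a_group (ar X) (kernel (ar X) (ob X) (dm X) \<inter> pcone (ar X))"
proof
  assume "internal_groupoid X"
  then obtain \<sigma> where \<sigma>: "\<sigma> \<in> rpo_hom (ar X) (ar X)"
    and d: "\<And>a. a \<in> carrier (ar X) \<Longrightarrow> dm X (\<sigma> a) = cd X a"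
    and c: "\<And>a. a \<in> carrier (ar X) \<Longrightarrow> cd X (\<sigma> a) = dm X a"
    and m: "\<And>a. a \<in> carrier (ar X) \<Longrightarrow> cmp X (a, \<sigma> a) = idt X (cd X a)"
    unfolding internal_groupoid_def by auto
  show "is_a_group (ar X) (kernel (ar X) (ob X) (dm X) \<inter> pcone (ar X))"
    unfolding is_a_group_def
  proof
    fix a assume "a \<in> kernel (ar X) (ob X) (dm X) \<inter> pcone (ar X)"
    then have a: "a \<in> carrier (ar X)" "dm X a = \<one>\<^bsub>ob X\<^esub>" "a \<in> pcone (ar X)"
      by (auto simp: kernel_def)
    note sa = rpo_hom_closed[OF \<sigma> a(1)]
    \<comment> \<open>As \<open>dm X a\<close> is trivial, \<open>cmp_eq\<close> turns this
      composite into a plain product, which can be solved for \<open>\<sigma> a\<close>.\<close>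
    have "a \<otimes>\<^bsub>ar X\<^esub> \<sigma> a = idt X (cd X a)"
      using m[OF a(1)] a sa by (simp add: cmp_eq c)
    then have "\<sigma> a = inv\<^bsub>ar X\<^esub> a \<otimes>\<^bsub>ar X\<^esub> idt X (cd X a)"
      using ar.mult_inv_cancel(2)[OF a(1) sa] by simp
    \<comment> \<open>The kernel part of the positive element \<open>\<sigma> a\<close> is
      \<open>inv a\<close>, so the Schreier condition makes \<open>inv a\<close> positive.\<close>
    then have "\<sigma> a \<otimes>\<^bsub>ar X\<^esub> inv\<^bsub>ar X\<^esub> idt X (dm X (\<sigma> a)) = inv\<^bsub>ar X\<^esub> a"
      using a by (simp add: d ar.m_assoc)
    with pcone_ker_part[OF rpo_hom_pcone[OF \<sigma> a(3)]]
    show "inv\<^bsub>ar X\<^esub> a \<in> kernel (ar X) (ob X) (dm X) \<inter> pcone (ar X)"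
      using a by (simp add: kernel_def)
  qed
next
  assume grp: "is_a_group (ar X) (kernel (ar X) (ob X) (dm X) \<inter> pcone (ar X))"
  \<comment> \<open>Solution of \<open>a \<otimes> inv (idt X (dm X a)) \<otimes> \<sigma> a = idt X
    (cd X a)\<close>, which is what \<open>cmp_eq\<close> makes of the first inverse law.\<close>
  define \<sigma> where "\<sigma> = (\<lambda>a\<in>carrier (ar X). idt X (dm X a) \<otimes>\<^bsub>ar X\<^esub> inv\<^bsub>ar X\<^esub> a \<otimes>\<^bsub>ar X\<^esub> idt X (cd X a))"
  have "\<sigma> \<in> rpo_hom (ar X) (ar X)"
  proof (rule rpo_homI)
    fix a b assume a: "a \<in> carrier (ar X)" and b: "b \<in> carrier (ar X)"
    \<comment> \<open>The factors of \<open>\<sigma> (a \<otimes> b)\<close> stand in the wrong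
      order in the middle. Since \<open>?k\<close> lies in the kernel of \<open>dm X\<close> and
      \<open>?z\<close> in that of \<open>cd X\<close>, they can be exchanged.\<close>
    let ?k = "idt X (dm X b) \<otimes>\<^bsub>ar X\<^esub> inv\<^bsub>ar X\<^esub> b" and ?z = "inv\<^bsub>ar X\<^esub> a \<otimes>\<^bsub>ar X\<^esub> idt X (cd X a)"
    have "\<sigma> (a \<otimes>\<^bsub>ar X\<^esub> b) = idt X (dm X a) \<otimes>\<^bsub>ar X\<^esub> (?k \<otimes>\<^bsub>ar X\<^esub> ?z) \<otimes>\<^bsub>ar X\<^esub> idt X (cd X b)"
      using a b by (simp add: \<sigma>_def ar.m_assoc ar.inv_mult_group)
    also have "?k \<otimes>\<^bsub>ar X\<^esub> ?z = ?z \<otimes>\<^bsub>ar X\<^esub> ?k"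
      using a b by (intro ker_dm_commutes_ker_cd) auto
    also have "idt X (dm X a) \<otimes>\<^bsub>ar X\<^esub> (?z \<otimes>\<^bsub>ar X\<^esub> ?k) \<otimes>\<^bsub>ar X\<^esub> idt X (cd X b) = \<sigma> a \<otimes>\<^bsub>ar X\<^esub> \<sigma> b"
      using a b by (simp add: \<sigma>_def ar.m_assoc)
    finally show "\<sigma> (a \<otimes>\<^bsub>ar X\<^esub> b) = \<sigma> a \<otimes>\<^bsub>ar X\<^esub> \<sigma> b" .
  next
    fix a assume p: "a \<in> pcone (ar X)"
    then have a: "a \<in> carrier (ar X)" using rpogroupD(2)[OF rpogroup_ar] by auto
    \<comment> \<open>The inverse of this kernel part times \<open>idt X (cd X a)\<close> is
      \<open>\<sigma> a\<close>.\<close>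
    have "a \<otimes>\<^bsub>ar X\<^esub> inv\<^bsub>ar X\<^esub> idt X (dm X a) \<in> kernel (ar X) (ob X) (dm X) \<inter> pcone (ar X)"
      using a pcone_ker_part[OF p] by (simp add: kernel_def)
    then have "inv\<^bsub>ar X\<^esub> (a \<otimes>\<^bsub>ar X\<^esub> inv\<^bsub>ar X\<^esub> idt X (dm X a)) \<in> pcone (ar X)"
      using grp unfolding is_a_group_def by blast
    then have "idt X (dm X a) \<otimes>\<^bsub>ar X\<^esub> inv\<^bsub>ar X\<^esub> a \<in> pcone (ar X)"
      using a by (simp add: ar.inv_mult_group del: idt.hom_inv)
    moreover have "idt X (cd X a) \<in> pcone (ar X)"
      using p rpo_hom_pcone[OF cd_hom] rpo_hom_pcone[OF idt_hom] by blast
    ultimately show "\<sigma> a \<in> pcone (ar X)"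
      using a rpogroupD(4)[OF rpogroup_ar] by (simp add: \<sigma>_def)
  qed (auto simp: \<sigma>_def)
  moreover have d: "dm X (\<sigma> a) = cd X a" and c: "cd X (\<sigma> a) = dm X a" if "a \<in> carrier (ar X)" for a
    using that by (simp_all add: \<sigma>_def ob.word_simps)
  moreover have "cmp X (a, \<sigma> a) = idt X (cd X a)" and "cmp X (\<sigma> a, a) = idt X (dm X a)"
    if a: "a \<in> carrier (ar X)" for a
  proof -
    have sa: "\<sigma> a \<in> carrier (ar X)" and sa_eq: "\<sigma> a = idt X (dm X a) \<otimes>\<^bsub>ar X\<^esub> (inv\<^bsub>ar X\<^esub> a \<otimes>\<^bsub>ar X\<^esub> idt X (cd X a))"
      using a by (simp_all add: \<sigma>_def ar.m_assoc)
    have "cmp X (a, \<sigma> a) = a \<otimes>\<^bsub>ar X\<^esub> inv\<^bsub>ar X\<^esub> idt X (dm X a) \<otimes>\<^bsub>ar X\<^esub> \<sigma> a"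
      using a sa c by (simp add: cmp_eq)
    also have "\<dots> = idt X (cd X a)"
      unfolding sa_eq using a by (simp add: ar.m_assoc ar.mult_inv_cancel del: idt.hom_inv)
    finally show "cmp X (a, \<sigma> a) = idt X (cd X a)" .
    have "cmp X (\<sigma> a, a) = \<sigma> a \<otimes>\<^bsub>ar X\<^esub> inv\<^bsub>ar X\<^esub> idt X (cd X a) \<otimes>\<^bsub>ar X\<^esub> a"
      using a sa d by (simp add: cmp_eq)
    also have "\<dots> = idt X (dm X a)"
      unfolding sa_eq using a by (simp add: ar.m_assoc del: idt.hom_inv)
    finally show "cmp X (\<sigma> a, a) = idt X (dm X a)" .
  qed
  ultimately show "internal_groupoid X"
    unfolding internal_groupoid_def using internal by blast
qed

end

section \<open>The comparison functor is fully faithful\<close>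

lemma SchCat_simps:
  "Obj SchCat = {X. schreier_category X}"
  "Hom SchCat = internal_functors"
  "Id SchCat X = (\<lambda>x\<in>carrier (ob X). x, \<lambda>a\<in>carrier (ar X). a)"
  "Comp SchCat X Y Z (g0, g1) (f0, f1) = (compose (carrier (ob X)) g0 f0, compose (carrier (ar X)) g1 f1)"
  by (simp_all add: SchCat_def)

lemma XMod_simps:
  "Obj XMod = {M. crossed_module M}"
  "Hom XMod = xmod_homs"
  "Id XMod M = (\<lambda>x\<in>carrier (base M). x, \<lambda>a\<in>carrier (fibre M). a)"
  "Comp XMod L M N (h0, h1) (g0, g1) = (compose (carrier (base L)) h0 g0, compose (carrier (fibre L)) h1 g1)"
  by (simp_all add: XMod_def)

text \<open>Internal functors preserve composition automatically, by \<open>schreier_cat.cmp_eq\<close>.\<close>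

lemma internal_functors_iff:
  assumes "schreier_category X" "schreier_category Y"
  shows "(f0, f1) \<in> internal_functors X Y \<longleftrightarrow>
    f0 \<in> rpo_hom (ob X) (ob Y) \<and> f1 \<in> rpo_hom (ar X) (ar Y) \<and>
    (\<forall>a\<in>carrier (ar X). dm Y (f1 a) = f0 (dm X a) \<and> cd Y (f1 a) = f0 (cd X a)) \<and>
    (\<forall>x\<in>carrier (ob X). f1 (idt X x) = idt Y (f0 x))"
proof -
  interpret X: schreier_cat X by unfold_locales (rule assms)
  interpret Y: schreier_cat Y by unfold_locales (rule assms)
  have "f1 (cmp X (a, b)) = cmp Y (f1 a, f1 b)"
    if f1: "f1 \<in> rpo_hom (ar X) (ar Y)"
      and d: "\<forall>a\<in>carrier (ar X). dm Y (f1 a) = f0 (dm X a) \<and> cd Y (f1 a) = f0 (cd X a)"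
      and i: "\<forall>x\<in>carrier (ob X). f1 (idt X x) = idt Y (f0 x)"
      and ab: "a \<in> carrier (ar X)" "b \<in> carrier (ar X)" "dm X a = cd X b" for a b
  proof -
    interpret f1: group_hom "ar X" "ar Y" f1
      by (rule group_hom_rpo_hom[OF X.rpogroup_ar Y.rpogroup_ar f1])
    show ?thesis
      using ab d i by (simp add: X.cmp_eq Y.cmp_eq del: X.idt.hom_inv Y.idt.hom_inv)
  qed
  then show ?thesis
    unfolding internal_functors_def by (auto simp: composable_simps)
qed

lemma category_SchCat: "category SchCat"
  unfolding category_def
proof (intro conjI ballI)
  fix X :: "('a, 'b) intcat" assume "X \<in> Obj SchCat"
  then interpret X: schreier_cat X by unfold_locales (simp add: SchCat_simps)
  show "Id SchCat X \<in> Hom SchCat X X"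
    by (simp add: SchCat_simps internal_functors_iff[OF X.schreier X.schreier]
        rpo_hom_id X.rpogroup_ob X.rpogroup_ar)
next
  fix X Y Z :: "('a, 'b) intcat" and f g
  assume "X \<in> Obj SchCat" "Y \<in> Obj SchCat" "Z \<in> Obj SchCat"
    and fg: "f \<in> Hom SchCat X Y" "g \<in> Hom SchCat Y Z"
  then interpret X: schreier_cat X + Y: schreier_cat Y + Z: schreier_cat Z
    by (unfold_locales; simp add: SchCat_simps)+
  obtain f0 f1 g0 g1 where eq: "f = (f0, f1)" "g = (g0, g1)" by (metis surj_pair)
  have f: "f0 \<in> rpo_hom (ob X) (ob Y)" "f1 \<in> rpo_hom (ar X) (ar Y)"
    "\<And>a. a \<in> carrier (ar X) \<Longrightarrow> dm Y (f1 a) = f0 (dm X a) \<and> cd Y (f1 a) = f0 (cd X a)"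
    "\<And>x. x \<in> carrier (ob X) \<Longrightarrow> f1 (idt X x) = idt Y (f0 x)"
    using fg by (simp_all add: SchCat_simps eq internal_functors_iff X.schreier Y.schreier)
  have g: "g0 \<in> rpo_hom (ob Y) (ob Z)" "g1 \<in> rpo_hom (ar Y) (ar Z)"
    "\<And>a. a \<in> carrier (ar Y) \<Longrightarrow> dm Z (g1 a) = g0 (dm Y a) \<and> cd Z (g1 a) = g0 (cd Y a)"
    "\<And>x. x \<in> carrier (ob Y) \<Longrightarrow> g1 (idt Y x) = idt Z (g0 x)"
    using fg by (simp_all add: SchCat_simps eq internal_functors_iff Y.schreier Z.schreier)
  show "Comp SchCat X Y Z g f \<in> Hom SchCat X Z"
    using f g rpo_hom_compose[OF X.rpogroup_ob f(1) g(1)] rpo_hom_compose[OF X.rpogroup_ar f(2) g(2)]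
      rpo_hom_closed[OF f(1)] rpo_hom_closed[OF f(2)]
    by (simp add: SchCat_simps eq internal_functors_iff X.schreier Z.schreier compose_eq)
next
  fix X Y :: "('a, 'b) intcat" and f
  assume "X \<in> Obj SchCat" "Y \<in> Obj SchCat" "f \<in> Hom SchCat X Y"
  then obtain f0 f1 where eq: "f = (f0, f1)"
    and f: "f0 \<in> rpo_hom (ob X) (ob Y)" "f1 \<in> rpo_hom (ar X) (ar Y)"
    by (cases f) (simp add: SchCat_simps internal_functors_def)
  have "f0 \<in> carrier (ob X) \<rightarrow> carrier (ob Y)" "f1 \<in> carrier (ar X) \<rightarrow> carrier (ar Y)"
    using rpo_hom_closed[OF f(1)] rpo_hom_closed[OF f(2)] by auto
  then show "Comp SchCat X X Y f (Id SchCat X) = f" "Comp SchCat X Y Y (Id SchCat Y) f = f"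
    using f by (simp_all add: SchCat_simps eq rpo_hom_ext)
next
  fix W X Y Z :: "('a, 'b) intcat" and f g h
  assume "f \<in> Hom SchCat W X" "g \<in> Hom SchCat X Y" "h \<in> Hom SchCat Y Z"
  moreover obtain f0 f1 g0 g1 h0 h1 where eq: "f = (f0, f1)" "g = (g0, g1)" "h = (h0, h1)"
    by (metis surj_pair)
  ultimately have f: "f0 \<in> rpo_hom (ob W) (ob X)" "f1 \<in> rpo_hom (ar W) (ar X)"
    by (simp_all add: SchCat_simps internal_functors_def)
  have "f0 \<in> carrier (ob W) \<rightarrow> carrier (ob X)" "f1 \<in> carrier (ar W) \<rightarrow> carrier (ar X)"
    using rpo_hom_closed[OF f(1)] rpo_hom_closed[OF f(2)] by auto
  then show "Comp SchCat W X Z (Comp SchCat X Y Z h g) f = Comp SchCat W Y Z h (Comp SchCat W X Y g f)"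
    by (simp add: SchCat_simps eq compose_assoc)
qed

lemma xmod_homsD:
  assumes "(g0, g1) \<in> xmod_homs M N"
  shows "g0 \<in> rpo_hom (base M) (base N)" "g1 \<in> rpo_hom (fibre M) (fibre N)"
    "\<And>a. a \<in> carrier (fibre M) \<Longrightarrow> g0 (bdry M a) = bdry N (g1 a)"
    "\<And>x a. \<lbrakk>x \<in> carrier (base M); a \<in> carrier (fibre M)\<rbrakk> \<Longrightarrow> g1 (act M x a) = act N (g0 x) (g1 a)"
  using assms by (simp_all add: xmod_homs_def)

lemma category_XMod: "category XMod"
  unfolding category_def
proof (intro conjI ballI)
  fix M :: "('a, 'b) xmod" assume "M \<in> Obj XMod"
  then interpret M: crossed_mod M by unfold_locales (simp add: XMod_simps)
  show "Id XMod M \<in> Hom XMod M M"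
    by (simp add: XMod_simps xmod_homs_def rpo_hom_id M.rpogroup_base M.rpogroup_fibre)
next
  fix L M N :: "('a, 'b) xmod" and f g
  assume "L \<in> Obj XMod" "M \<in> Obj XMod" "N \<in> Obj XMod"
    and fg: "f \<in> Hom XMod L M" "g \<in> Hom XMod M N"
  then interpret L: crossed_mod L by (unfold_locales; simp add: XMod_simps)
  obtain f0 f1 g0 g1 where eq: "f = (f0, f1)" "g = (g0, g1)" by (metis surj_pair)
  have f: "(f0, f1) \<in> xmod_homs L M" and g: "(g0, g1) \<in> xmod_homs M N"
    using fg by (simp_all add: XMod_simps eq)
  note f = xmod_homsD[OF f] and g = xmod_homsD[OF g]
  show "Comp XMod L M N g f \<in> Hom XMod L N"
    using f g rpo_hom_compose[OF L.rpogroup_base f(1) g(1)] rpo_hom_compose[OF L.rpogroup_fibre f(2) g(2)]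
      rpo_hom_closed[OF f(1)] rpo_hom_closed[OF f(2)]
    by (simp add: XMod_simps eq xmod_homs_def compose_eq)
next
  fix M N :: "('a, 'b) xmod" and f
  assume "f \<in> Hom XMod M N"
  then obtain f0 f1 where eq: "f = (f0, f1)"
    and f: "f0 \<in> rpo_hom (base M) (base N)" "f1 \<in> rpo_hom (fibre M) (fibre N)"
    by (cases f) (simp add: XMod_simps xmod_homs_def)
  have "f0 \<in> carrier (base M) \<rightarrow> carrier (base N)" "f1 \<in> carrier (fibre M) \<rightarrow> carrier (fibre N)"
    using rpo_hom_closed[OF f(1)] rpo_hom_closed[OF f(2)] by auto
  then show "Comp XMod M M N f (Id XMod M) = f" "Comp XMod M N N (Id XMod N) f = f"
    using f by (simp_all add: XMod_simps eq rpo_hom_ext)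
next
  fix K L M N :: "('a, 'b) xmod" and f g h
  assume "f \<in> Hom XMod K L" "g \<in> Hom XMod L M" "h \<in> Hom XMod M N"
  moreover obtain f0 f1 g0 g1 h0 h1 where eq: "f = (f0, f1)" "g = (g0, g1)" "h = (h0, h1)"
    by (metis surj_pair)
  ultimately have f: "f0 \<in> rpo_hom (base K) (base L)" "f1 \<in> rpo_hom (fibre K) (fibre L)"
    by (simp_all add: XMod_simps xmod_homs_def)
  have "f0 \<in> carrier (base K) \<rightarrow> carrier (base L)" "f1 \<in> carrier (fibre K) \<rightarrow> carrier (fibre L)"
    using rpo_hom_closed[OF f(1)] rpo_hom_closed[OF f(2)] by auto
  then show "Comp XMod K L N (Comp XMod L M N h g) f = Comp XMod K M N h (Comp XMod K L M g f)"
    by (simp add: XMod_simps eq compose_assoc)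
qed

section \<open>Internal functors correspond to morphisms of crossed modules\<close>

locale schreier_cat_pair = X: schreier_cat X + Y: schreier_cat Y
  for X Y :: "('a, 'b) intcat"
begin

lemma functor_ker_d:
  assumes "(f0, f1) \<in> internal_functors X Y" "a \<in> carrier (ker_d X)"
  shows "f1 a \<in> carrier (ker_d Y)"
proof -
  have f: "f0 \<in> rpo_hom (ob X) (ob Y)" "f1 \<in> rpo_hom (ar X) (ar Y)"
    "\<And>a. a \<in> carrier (ar X) \<Longrightarrow> dm Y (f1 a) = f0 (dm X a)"
    using assms(1) by (simp_all add: internal_functors_iff X.schreier Y.schreier)
  interpret f0: group_hom "ob X" "ob Y" f0
    by (rule group_hom_rpo_hom[OF X.rpogroup_ob Y.rpogroup_ob f(1)])
  show ?thesis
    using assms(2) f rpo_hom_closed[OF f(2)] by (simp add: X.ker_d_simps Y.ker_d_simps)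
qed

lemma to_xmod_arr_Hom:
  assumes "(f0, f1) \<in> internal_functors X Y"
  shows "to_xmod_arr X Y (f0, f1) \<in> xmod_homs (to_xmod X) (to_xmod Y)"
proof -
  have f: "f0 \<in> rpo_hom (ob X) (ob Y)" "f1 \<in> rpo_hom (ar X) (ar Y)"
    "\<And>a. a \<in> carrier (ar X) \<Longrightarrow> dm Y (f1 a) = f0 (dm X a)"
    "\<And>a. a \<in> carrier (ar X) \<Longrightarrow> cd Y (f1 a) = f0 (cd X a)"
    "\<And>x. x \<in> carrier (ob X) \<Longrightarrow> f1 (idt X x) = idt Y (f0 x)"
    using assms by (simp_all add: internal_functors_iff X.schreier Y.schreier)
  note k = functor_ker_d[OF assms]
  interpret f0: group_hom "ob X" "ob Y" f0
    by (rule group_hom_rpo_hom[OF X.rpogroup_ob Y.rpogroup_ob f(1)])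
  interpret f1: group_hom "ar X" "ar Y" f1
    by (rule group_hom_rpo_hom[OF X.rpogroup_ar Y.rpogroup_ar f(2)])
  have sub: "a \<in> carrier (ar X)" if "a \<in> carrier (ker_d X)" for a
    using that by (simp add: X.ker_d_simps)
  have "restrict f1 (carrier (ker_d X)) \<in> rpo_hom (ker_d X) (ker_d Y)"
    using k rpo_hom_pcone[OF f(2)] f rpogroupD(2)[OF X.rpogroup_ar]
    by (intro rpo_homI) (auto simp: X.ker_d_simps Y.ker_d_simps)
  moreover have "f1 (act (to_xmod X) x a) = act (to_xmod Y) (f0 x) (f1 a)"
    if "x \<in> carrier (ob X)" "a \<in> carrier (ker_d X)" for x a
    using that k[OF that(2)] sub[OF that(2)] f
    by (simp add: X.to_xmod_simps Y.to_xmod_simps del: X.idt.hom_inv Y.idt.hom_inv)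
  \<comment> \<open>Allows the restriction of \<open>f1\<close> to be evaluated at the result of the
    action.\<close>
  moreover have "act (to_xmod X) x a \<in> carrier (ker_d X)" if "x \<in> carrier (ob X)" "a \<in> carrier (ker_d X)" for x a
    using crossed_mod.act_closed[OF crossed_mod.intro[OF X.crossed_module_to_xmod]] that
    by (simp add: X.to_xmod_simps(1,2))
  ultimately show ?thesis
    using f sub k by (simp add: to_xmod_arr_def xmod_homs_def X.to_xmod_simps Y.to_xmod_simps)
qed

text \<open>Gives faithfulness at once, and dictates the extension chosen in
  \<open>to_xmod_arr_surj\<close>.\<close>

lemma functor_eq_on_ker:
  assumes f: "(f0, f1) \<in> internal_functors X Y" and a: "a \<in> carrier (ar X)"
  shows "f1 a = f1 (a \<otimes>\<^bsub>ar X\<^esub> inv\<^bsub>ar X\<^esub> idt X (dm X a)) \<otimes>\<^bsub>ar Y\<^esub> idt Y (f0 (dm X a))"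
proof -
  have f: "f1 \<in> rpo_hom (ar X) (ar Y)" "f1 (idt X (dm X a)) = idt Y (f0 (dm X a))"
    using f a by (simp_all add: internal_functors_iff X.schreier Y.schreier)
  interpret f1: group_hom "ar X" "ar Y" f1
    by (rule group_hom_rpo_hom[OF X.rpogroup_ar Y.rpogroup_ar f(1)])
  have "f1 a = f1 (a \<otimes>\<^bsub>ar X\<^esub> inv\<^bsub>ar X\<^esub> idt X (dm X a) \<otimes>\<^bsub>ar X\<^esub> idt X (dm X a))"
    using a by (simp only: X.ar.m_assoc X.ar.l_inv X.ar.r_one X.ar.inv_closed X.idt.hom_closed X.dm.hom_closed)
  also have "\<dots> = f1 (a \<otimes>\<^bsub>ar X\<^esub> inv\<^bsub>ar X\<^esub> idt X (dm X a)) \<otimes>\<^bsub>ar Y\<^esub> f1 (idt X (dm X a))"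
    using a by (intro f1.hom_mult) simp_all
  finally show ?thesis using f by simp
qed

lemma to_xmod_arr_inj: "inj_on (to_xmod_arr X Y) (internal_functors X Y)"
proof (rule inj_onI, clarify)
  fix f0 f1 g0 g1
  assume f: "(f0, f1) \<in> internal_functors X Y" and g: "(g0, g1) \<in> internal_functors X Y"
    and "to_xmod_arr X Y (f0, f1) = to_xmod_arr X Y (g0, g1)"
  then have 0: "f0 = g0" and "restrict f1 (carrier (ker_d X)) = restrict g1 (carrier (ker_d X))"
    by (simp_all add: to_xmod_arr_def)
  then have 1: "f1 a = g1 a" if "a \<in> carrier (ker_d X)" for a
    using that by (metis restrict_apply')
  have "f1 = g1"
  proof (rule rpo_hom_extensional_eq)
    show "f1 \<in> rpo_hom (ar X) (ar Y)" "g1 \<in> rpo_hom (ar X) (ar Y)"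
      using f g by (simp_all add: internal_functors_iff X.schreier Y.schreier)
    show "f1 a = g1 a" if "a \<in> carrier (ar X)" for a
      using functor_eq_on_ker[OF f that] functor_eq_on_ker[OF g that] 0 1[OF X.ker_part[OF that]] by simp
  qed
  with 0 show "f0 = g0 \<and> f1 = g1" by simp
qed

text \<open>The forced extension of \<open>g1\<close> works because each axiom of a morphism pays
  for one property: equivariance for multiplicativity, preservation of the cones together with the
  Schreier condition for positivity, compatibility with the boundary for codomains.\<close>

lemma to_xmod_arr_surj:
  assumes "(g0, g1) \<in> xmod_homs (to_xmod X) (to_xmod Y)"
  shows "(g0, g1) \<in> to_xmod_arr X Y ` internal_functors X Y"
proof -
  note g = xmod_homsD[OF assms, unfolded X.to_xmod_simps(1,2) Y.to_xmod_simps(1,2)]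
  interpret g0: group_hom "ob X" "ob Y" g0
    by (rule group_hom_rpo_hom[OF X.rpogroup_ob Y.rpogroup_ob g(1)])
  interpret g1: group_hom "ker_d X" "ker_d Y" g1
    by (rule group_hom_rpo_hom[OF X.rpogroup_ker_d Y.rpogroup_ker_d g(2)])
  have kY: "g1 a \<in> carrier (ker_d Y)" "g1 a \<in> carrier (ar Y)" "dm Y (g1 a) = \<one>\<^bsub>ob Y\<^esub>"
    and g_cd: "cd Y (g1 a) = g0 (cd X a)" if "a \<in> carrier (ker_d X)" for a
    using rpo_hom_closed[OF g(2) that] g(3)[OF that] that
    by (simp_all add: Y.ker_d_simps X.to_xmod_simps Y.to_xmod_simps)
  have g_mult: "g1 (a \<otimes>\<^bsub>ar X\<^esub> b) = g1 a \<otimes>\<^bsub>ar Y\<^esub> g1 b"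
    if "a \<in> carrier (ker_d X)" "b \<in> carrier (ker_d X)" for a b
    using rpo_hom_mult[OF g(2) that] by (simp add: X.ker_d_simps Y.ker_d_simps)
  have g_one: "g1 \<one>\<^bsub>ar X\<^esub> = \<one>\<^bsub>ar Y\<^esub>"
    using g1.hom_one by (simp add: X.ker_d_simps Y.ker_d_simps)
  have g_act: "g1 (idt X x \<otimes>\<^bsub>ar X\<^esub> a \<otimes>\<^bsub>ar X\<^esub> inv\<^bsub>ar X\<^esub> idt X x) =
      idt Y (g0 x) \<otimes>\<^bsub>ar Y\<^esub> g1 a \<otimes>\<^bsub>ar Y\<^esub> inv\<^bsub>ar Y\<^esub> idt Y (g0 x)"
    if "x \<in> carrier (ob X)" "a \<in> carrier (ker_d X)" for x a
    using g(4)[OF that] that kY by (simp add: X.to_xmod_simps Y.to_xmod_simps del: X.idt.hom_inv Y.idt.hom_inv)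
  define k where "k a = a \<otimes>\<^bsub>ar X\<^esub> inv\<^bsub>ar X\<^esub> idt X (dm X a)" for a
  have k: "k a \<in> carrier (ker_d X)" if "a \<in> carrier (ar X)" for a
    unfolding k_def using that by (rule X.ker_part)
  define f1 where "f1 = (\<lambda>a\<in>carrier (ar X). g1 (k a) \<otimes>\<^bsub>ar Y\<^esub> idt Y (g0 (dm X a)))"
  have f1: "f1 \<in> rpo_hom (ar X) (ar Y)"
  proof (rule rpo_homI)
    fix a b assume ab: "a \<in> carrier (ar X)" "b \<in> carrier (ar X)"
    let ?e = "idt X (dm X a)" and ?e' = "idt Y (g0 (dm X a))"
    have kb: "?e \<otimes>\<^bsub>ar X\<^esub> k b \<otimes>\<^bsub>ar X\<^esub> inv\<^bsub>ar X\<^esub> ?e \<in> carrier (ker_d X)"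
      using ab k[OF ab(2)] by (simp add: X.ker_d_simps)
    \<comment> \<open>Taking kernel parts is a crossed homomorphism. Its twist is conjugation by an
      identity arrow, that is, the action, which \<open>g1\<close> respects.\<close>
    have "k (a \<otimes>\<^bsub>ar X\<^esub> b) = k a \<otimes>\<^bsub>ar X\<^esub> (?e \<otimes>\<^bsub>ar X\<^esub> k b \<otimes>\<^bsub>ar X\<^esub> inv\<^bsub>ar X\<^esub> ?e)"
      using ab by (simp add: k_def X.ar.word_simps del: X.idt.hom_inv)
    then have "g1 (k (a \<otimes>\<^bsub>ar X\<^esub> b)) = g1 (k a) \<otimes>\<^bsub>ar Y\<^esub> (?e' \<otimes>\<^bsub>ar Y\<^esub> g1 (k b) \<otimes>\<^bsub>ar Y\<^esub> inv\<^bsub>ar Y\<^esub> ?e')"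
      using ab k kb g_mult g_act by simp
    then show "f1 (a \<otimes>\<^bsub>ar X\<^esub> b) = f1 a \<otimes>\<^bsub>ar Y\<^esub> f1 b"
      using ab kY[OF k] by (simp add: f1_def Y.ar.word_simps del: Y.idt.hom_inv)
  next
    fix a assume p: "a \<in> pcone (ar X)"
    then have a: "a \<in> carrier (ar X)" using rpogroupD(2)[OF X.rpogroup_ar] by auto
    have "k a \<in> pcone (ker_d X)"
      using X.pcone_ker_part[OF p] k[OF a] by (simp add: k_def X.ker_d_simps)
    then have "g1 (k a) \<in> pcone (ar Y)"
      using rpo_hom_pcone[OF g(2)] by (simp add: Y.ker_d_simps)
    moreover have "idt Y (g0 (dm X a)) \<in> pcone (ar Y)"
      using p rpo_hom_pcone[OF Y.idt_hom] rpo_hom_pcone[OF g(1)] rpo_hom_pcone[OF X.dm_hom] by blast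
    ultimately show "f1 a \<in> pcone (ar Y)"
      using a rpogroupD(4)[OF Y.rpogroup_ar] by (simp add: f1_def)
  qed (use kY[OF k] in \<open>auto simp: f1_def\<close>)
  have "dm Y (f1 a) = g0 (dm X a)" if "a \<in> carrier (ar X)" for a
    using that kY[OF k[OF that]] by (simp add: f1_def)
  moreover have "cd Y (f1 a) = g0 (cd X a)" if a: "a \<in> carrier (ar X)" for a
  proof -
    \<comment> \<open>On the kernel part \<open>cd Y\<close> is controlled by the boundary
      condition, on the identity arrow it returns the object.\<close>
    have "cd Y (f1 a) = g0 (cd X (k a)) \<otimes>\<^bsub>ob Y\<^esub> g0 (dm X a)"
      using a kY[OF k[OF a]] g_cd[OF k[OF a]] by (simp add: f1_def)
    also have "\<dots> = g0 (cd X a)"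
      using a by (simp add: k_def Y.ob.m_assoc)
    finally show ?thesis .
  qed
  moreover have "f1 (idt X x) = idt Y (g0 x)" if "x \<in> carrier (ob X)" for x
    using that by (simp add: f1_def k_def g_one X.ar.r_inv del: X.idt.hom_inv)
  ultimately have "(g0, f1) \<in> internal_functors X Y"
    using f1 g(1) by (simp add: internal_functors_iff X.schreier Y.schreier)
  moreover have "restrict f1 (carrier (ker_d X)) = g1"
  proof (rule extensionalityI[OF _ rpo_hom_ext[OF g(2)]])
    fix a assume a: "a \<in> carrier (ker_d X)"
    then have "k a = a" by (simp add: k_def X.ker_d_simps)
    then show "restrict f1 (carrier (ker_d X)) a = g1 a"
      using a kY[OF a] by (simp add: f1_def X.ker_d_simps)
  qed simp
  ultimately show ?thesis
    by (auto simp: to_xmod_arr_def intro!: image_eqI[of _ _ "(g0, f1)"])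
qed

lemma to_xmod_arr_bij:
  "bij_betw (to_xmod_arr X Y) (internal_functors X Y) (xmod_homs (to_xmod X) (to_xmod Y))"
  unfolding bij_betw_def using to_xmod_arr_inj to_xmod_arr_surj to_xmod_arr_Hom by auto

end

lemma to_xmod_arr_Hom_bij:
  assumes "X \<in> Obj SchCat" "Y \<in> Obj SchCat"
  shows "bij_betw (to_xmod_arr X Y) (Hom SchCat X Y) (Hom XMod (to_xmod X) (to_xmod Y))"
  using assms schreier_cat_pair.to_xmod_arr_bij[of X Y]
  by (simp add: SchCat_simps XMod_simps schreier_cat_pair_def schreier_cat_def)

lemma cat_functor_to_xmod: "cat_functor SchCat XMod to_xmod to_xmod_arr"
  unfolding cat_functor_def
proof (intro conjI ballI category_SchCat category_XMod)
  fix X :: "('a, 'b) intcat" assume "X \<in> Obj SchCat"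
  then interpret X: schreier_cat X by unfold_locales (simp add: SchCat_simps)
  show "to_xmod X \<in> Obj XMod"
    by (simp add: XMod_simps X.crossed_module_to_xmod)
  show "to_xmod_arr X X (Id SchCat X) = Id XMod (to_xmod X)"
    by (auto simp: SchCat_simps XMod_simps to_xmod_arr_def X.to_xmod_simps X.ker_d_simps restrict_def)
next
  fix X Y :: "('a, 'b) intcat" and f
  assume "X \<in> Obj SchCat" "Y \<in> Obj SchCat" "f \<in> Hom SchCat X Y"
  then show "to_xmod_arr X Y f \<in> Hom XMod (to_xmod X) (to_xmod Y)"
    using bij_betwE[OF to_xmod_arr_Hom_bij] by blast
next
  fix X Y Z :: "('a, 'b) intcat" and f g
  assume o: "X \<in> Obj SchCat" "Y \<in> Obj SchCat" "Z \<in> Obj SchCat"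
    and fg: "f \<in> Hom SchCat X Y" "g \<in> Hom SchCat Y Z"
  interpret XY: schreier_cat_pair X Y using o by unfold_locales (simp_all add: SchCat_simps)
  obtain f0 f1 g0 g1 where eq: "f = (f0, f1)" "g = (g0, g1)" by (metis surj_pair)
  have "(f0, f1) \<in> internal_functors X Y" using fg by (simp add: SchCat_simps eq)
  \<comment> \<open>Restricting \<open>g1\<close> before composing is harmless because
    \<open>f1\<close> maps kernel into kernel.\<close>
  from XY.functor_ker_d[OF this]
  show "to_xmod_arr X Z (Comp SchCat X Y Z g f) =
      Comp XMod (to_xmod X) (to_xmod Y) (to_xmod Z) (to_xmod_arr Y Z g) (to_xmod_arr X Y f)"
    by (auto simp: SchCat_simps XMod_simps eq to_xmod_arr_def XY.X.to_xmod_simps(1,2) compose_def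
        restrict_def XY.X.ker_d_simps(1))
qed

section \<open>The comparison functor is essentially surjective\<close>

text \<open>The semidirect product, with its elements transported along an injection \<open>\<phi>\<close>.\<close>

definition semidirect_ar :: "('b \<times> 'a \<Rightarrow> 'c) \<Rightarrow> ('a, 'b) xmod \<Rightarrow> 'c rpogrp" where
  "semidirect_ar \<phi> M =
    \<lparr>carrier = \<phi> ` (carrier (fibre M) \<times> carrier (base M)),
     mult = (\<lambda>u v. case (inv_into UNIV \<phi> u, inv_into UNIV \<phi> v) of ((a, x), (b, y)) \<Rightarrow>
       \<phi> (a \<otimes>\<^bsub>fibre M\<^esub> act M x b, x \<otimes>\<^bsub>base M\<^esub> y)),
     one = \<phi> (\<one>\<^bsub>fibre M\<^esub>, \<one>\<^bsub>base M\<^esub>),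
     pcone = \<phi> ` (pcone (fibre M) \<times> pcone (base M))\<rparr>"

text \<open>The element \<open>\<phi> (a, x)\<close> is an arrow from \<open>x\<close> to
  \<open>bdry M a \<otimes> x\<close>, and \<open>cmp\<close> is the composition that
  \<open>schreier_cat.cmp_eq\<close> dictates. Its domain is spelled out, since
  \<open>composable\<close> would need the category that is being defined.\<close>

definition semidirect :: "('b \<times> 'a \<Rightarrow> 'c) \<Rightarrow> ('a, 'b) xmod \<Rightarrow> ('a, 'c) intcat" where
  "semidirect \<phi> M =
    \<lparr>ob = base M,
     ar = semidirect_ar \<phi> M,
     dm = (\<lambda>u\<in>carrier (semidirect_ar \<phi> M). snd (inv_into UNIV \<phi> u)),
     cd = (\<lambda>u\<in>carrier (semidirect_ar \<phi> M). bdry M (fst (inv_into UNIV \<phi> u)) \<otimes>\<^bsub>base M\<^esub> snd (inv_into UNIV \<phi> u)),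
     idt = (\<lambda>x\<in>carrier (base M). \<phi> (\<one>\<^bsub>fibre M\<^esub>, x)),
     cmp = (\<lambda>(u, v)\<in>{(u, v). u \<in> carrier (semidirect_ar \<phi> M) \<and> v \<in> carrier (semidirect_ar \<phi> M) \<and>
         snd (inv_into UNIV \<phi> u) = bdry M (fst (inv_into UNIV \<phi> v)) \<otimes>\<^bsub>base M\<^esub> snd (inv_into UNIV \<phi> v)}.
       \<phi> (fst (inv_into UNIV \<phi> u) \<otimes>\<^bsub>fibre M\<^esub> fst (inv_into UNIV \<phi> v), snd (inv_into UNIV \<phi> v)))\<rparr>"

text \<open>Letting \<open>\<phi>\<close> land in the fibre's own type makes
  \<open>to_xmod S\<close> and \<open>M\<close> objects of one category.\<close>

locale semidirect_product = crossed_mod M for M :: "('a, 'b) xmod" +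
  fixes \<phi> :: "'b \<times> 'a \<Rightarrow> 'b"
  assumes inj: "inj \<phi>"
begin

abbreviation "S \<equiv> semidirect \<phi> M"

lemma carrier_S: "carrier (ar S) = \<phi> ` (carrier (fibre M) \<times> carrier (base M))"
  and pcone_S: "pcone (ar S) = \<phi> ` (pcone (fibre M) \<times> pcone (base M))"
  and one_S [simp]: "\<one>\<^bsub>ar S\<^esub> = \<phi> (\<one>\<^bsub>fibre M\<^esub>, \<one>\<^bsub>base M\<^esub>)"
  and mult_S [simp]: "\<phi> (a, x) \<otimes>\<^bsub>ar S\<^esub> \<phi> (b, y) = \<phi> (a \<otimes>\<^bsub>fibre M\<^esub> act M x b, x \<otimes>\<^bsub>base M\<^esub> y)"
  and ob_S [simp]: "ob S = base M"
  by (simp_all add: semidirect_def semidirect_ar_def inj)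

lemma phi_eq [simp]: "\<phi> p = \<phi> q \<longleftrightarrow> p = q"
  using inj by (rule inj_eq)

lemma in_S [simp]: "\<phi> (a, x) \<in> carrier (ar S) \<longleftrightarrow> a \<in> carrier (fibre M) \<and> x \<in> carrier (base M)"
  and in_pcone_S [simp]: "\<phi> (a, x) \<in> pcone (ar S) \<longleftrightarrow> a \<in> pcone (fibre M) \<and> x \<in> pcone (base M)"
  by (auto simp: carrier_S pcone_S)

lemma S_cases:
  assumes "u \<in> carrier (ar S)"
  obtains a x where "u = \<phi> (a, x)" "a \<in> carrier (fibre M)" "x \<in> carrier (base M)"
  using assms by (auto simp: carrier_S)

text \<open>The rule for \<open>cmp\<close> carries composability in its shape: the object in the
  first arrow is written as the codomain of the second.\<close>

lemma dm_S [simp]: "\<lbrakk>a \<in> carrier (fibre M); x \<in> carrier (base M)\<rbrakk> \<Longrightarrow> dm S (\<phi> (a, x)) = x"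
  and cd_S [simp]: "\<lbrakk>a \<in> carrier (fibre M); x \<in> carrier (base M)\<rbrakk> \<Longrightarrow>
    cd S (\<phi> (a, x)) = bdry M a \<otimes>\<^bsub>base M\<^esub> x"
  and idt_S [simp]: "x \<in> carrier (base M) \<Longrightarrow> idt S x = \<phi> (\<one>\<^bsub>fibre M\<^esub>, x)"
  and cmp_S [simp]: "\<lbrakk>a \<in> carrier (fibre M); b \<in> carrier (fibre M); y \<in> carrier (base M)\<rbrakk> \<Longrightarrow>
    cmp S (\<phi> (a, bdry M b \<otimes>\<^bsub>base M\<^esub> y), \<phi> (b, y)) = \<phi> (a \<otimes>\<^bsub>fibre M\<^esub> b, y)"
  using in_S by (simp_all add: semidirect_def inj del: in_S)

lemma ext_S: "dm S \<in> extensional (carrier (ar S))" "cd S \<in> extensional (carrier (ar S))"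
  "idt S \<in> extensional (carrier (ob S))" "cmp S \<in> extensional (carrier (composable S))"
proof -
  \<comment> \<open>The domain written out in the definition is the pullback.\<close>
  have "carrier (composable S) = {(u, v). u \<in> carrier (semidirect_ar \<phi> M) \<and> v \<in> carrier (semidirect_ar \<phi> M) \<and>
         snd (inv_into UNIV \<phi> u) = bdry M (fst (inv_into UNIV \<phi> v)) \<otimes>\<^bsub>base M\<^esub> snd (inv_into UNIV \<phi> v)}"
    by (auto simp: composable_simps semidirect_def)
  then show "cmp S \<in> extensional (carrier (composable S))"
    by (simp add: semidirect_def)
qed (simp_all add: semidirect_def)

lemma rpogroup_S: "rpogroup (ar S)"
  unfolding rpogroup_def
proof
  show "group (ar S)"
  proof (rule groupI)
    fix u assume "u \<in> carrier (ar S)"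
    then obtain a x where u: "u = \<phi> (a, x)" "a \<in> carrier (fibre M)" "x \<in> carrier (base M)"
      by (rule S_cases)
    \<comment> \<open>The left inverse of \<open>(a, x)\<close> is forced to have
      \<open>inv x\<close> as its object; its fibre component must cancel
      \<open>act M ?x a\<close>.\<close>
    let ?x = "inv\<^bsub>base M\<^esub> x"
    have "act M ?x (inv\<^bsub>fibre M\<^esub> a) \<otimes>\<^bsub>fibre M\<^esub> act M ?x a = \<one>\<^bsub>fibre M\<^esub>"
      using u by (simp flip: act_mult)
    then show "\<exists>v\<in>carrier (ar S). v \<otimes>\<^bsub>ar S\<^esub> u = \<one>\<^bsub>ar S\<^esub>"
      using u by (intro bexI[of _ "\<phi> (act M ?x (inv\<^bsub>fibre M\<^esub> a), ?x)"]) auto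
  qed (auto simp: act_act fibre.m_assoc base.m_assoc elim!: S_cases)
  \<comment> \<open>Closure under the twisted product uses that positive elements of the base
    preserve the cone of the fibre.\<close>
  show "submonoid (pcone (ar S)) (ar S)"
    using rpogroupD[OF rpogroup_base] rpogroupD[OF rpogroup_fibre]
    by unfold_locales (auto simp: pcone_S carrier_S act_pcone simp flip: image_iff)
qed

lemma pcone_S_cases:
  assumes "u \<in> pcone (ar S)"
  obtains a x where "u = \<phi> (a, x)" "a \<in> pcone (fibre M)" "x \<in> pcone (base M)"
    "a \<in> carrier (fibre M)" "x \<in> carrier (base M)"
  using assms rpogroupD(2)[OF rpogroup_base] rpogroupD(2)[OF rpogroup_fibre] by (auto simp: pcone_S)

lemma dm_hom_S: "dm S \<in> rpo_hom (ar S) (ob S)"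
  by (rule rpo_homI) (auto simp: ext_S elim!: S_cases pcone_S_cases)

text \<open>Multiplicativity is equivariance of the boundary: \<open>bdry_act\<close> rewrites
  \<open>bdry M (act M x b) \<otimes> x\<close> to \<open>x \<otimes> bdry M b\<close>.\<close>

lemma cd_hom_S: "cd S \<in> rpo_hom (ar S) (ob S)"
proof (rule rpo_homI)
  show "cd S u \<in> pcone (ob S)" if "u \<in> pcone (ar S)" for u
    using that rpo_hom_pcone[OF bdry_hom] rpogroupD(4)[OF rpogroup_base]
    by (auto elim!: pcone_S_cases)
qed (auto simp: ext_S bdry_act base.word_simps elim!: S_cases)

lemma idt_hom_S: "idt S \<in> rpo_hom (ob S) (ar S)"
  using ext_S(3) rpogroupD(2)[OF rpogroup_base] rpogroupD(3)[OF rpogroup_fibre]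
  by (intro rpo_homI) auto

lemma composable_S_cases:
  assumes "(u, v) \<in> carrier (composable S)"
  obtains a b y where "u = \<phi> (a, bdry M b \<otimes>\<^bsub>base M\<^esub> y)" "v = \<phi> (b, y)"
    "a \<in> carrier (fibre M)" "b \<in> carrier (fibre M)" "y \<in> carrier (base M)"
  using assms by (auto simp: composable_simps elim!: S_cases)

lemma cmp_hom_S: "cmp S \<in> rpo_hom (composable S) (ar S)"
proof (rule rpo_homI)
  fix p assume "p \<in> carrier (composable S)"
  then show "cmp S p \<in> carrier (ar S)"
    by (cases p) (auto elim!: composable_S_cases)
next
  fix p q assume pq: "p \<in> carrier (composable S)" "q \<in> carrier (composable S)"
  obtain a b y where p: "p = (\<phi> (a, bdry M b \<otimes>\<^bsub>base M\<^esub> y), \<phi> (b, y))"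
    "a \<in> carrier (fibre M)" "b \<in> carrier (fibre M)" "y \<in> carrier (base M)"
    using pq(1) by (cases p) (auto elim!: composable_S_cases)
  obtain a' b' y' where q: "q = (\<phi> (a', bdry M b' \<otimes>\<^bsub>base M\<^esub> y'), \<phi> (b', y'))"
    "a' \<in> carrier (fibre M)" "b' \<in> carrier (fibre M)" "y' \<in> carrier (base M)"
    using pq(2) by (cases q) (auto elim!: composable_S_cases)
  \<comment> \<open>By equivariance the product of the two pairs again has the shape that
    \<open>cmp_S\<close> expects.\<close>
  have "bdry M b \<otimes>\<^bsub>base M\<^esub> y \<otimes>\<^bsub>base M\<^esub> (bdry M b' \<otimes>\<^bsub>base M\<^esub> y') =
      bdry M (b \<otimes>\<^bsub>fibre M\<^esub> act M y b') \<otimes>\<^bsub>base M\<^esub> (y \<otimes>\<^bsub>base M\<^esub> y')"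
    using p q by (simp add: bdry_act base.word_simps)
  \<comment> \<open>Here the Peiffer identity gives the interchange law: \<open>bdry M b\<close>
    acts as conjugation by \<open>b\<close>, and the trailing \<open>inv b\<close> cancels against
    the next factor.\<close>
  moreover have "a \<otimes>\<^bsub>fibre M\<^esub> act M (bdry M b \<otimes>\<^bsub>base M\<^esub> y) a' \<otimes>\<^bsub>fibre M\<^esub> (b \<otimes>\<^bsub>fibre M\<^esub> act M y b') =
      a \<otimes>\<^bsub>fibre M\<^esub> b \<otimes>\<^bsub>fibre M\<^esub> act M y (a' \<otimes>\<^bsub>fibre M\<^esub> b')"
    using p q by (simp add: act_act act_bdry fibre.word_simps)
  ultimately show "cmp S (p \<otimes>\<^bsub>composable S\<^esub> q) = cmp S p \<otimes>\<^bsub>ar S\<^esub> cmp S q"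
    using p q by (simp add: composable_simps del: act_mult bdry.hom_mult)
next
  fix p assume "p \<in> pcone (composable S)"
  then obtain a x b y where p: "p = (\<phi> (a, x), \<phi> (b, y))" "a \<in> carrier (fibre M)" "b \<in> carrier (fibre M)"
    "y \<in> carrier (base M)" "x \<in> carrier (base M)" "dm S (\<phi> (a, x)) = cd S (\<phi> (b, y))"
    "a \<in> pcone (fibre M)" "b \<in> pcone (fibre M)" "y \<in> pcone (base M)"
    by (auto simp: composable_simps elim!: pcone_S_cases)
  then show "cmp S p \<in> pcone (ar S)"
    using rpogroupD(4)[OF rpogroup_fibre] by simp
qed (rule ext_S)

lemma schreier_category_S: "schreier_category S"
  unfolding schreier_category_def schreier_split_epi_def internal_category_def
proof (intro conjI ballI dm_hom_S cd_hom_S idt_hom_S cmp_hom_S rpogroup_S)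
  show "rpogroup (ob S)" by (simp add: rpogroup_base)
next
  fix p assume "p \<in> carrier (composable S)"
  then show "case p of (a, b) \<Rightarrow> dm S (cmp S (a, b)) = dm S b \<and> cd S (cmp S (a, b)) = cd S a"
    by (cases p) (auto simp: base.m_assoc elim!: composable_S_cases)
next
  fix u assume u: "u \<in> carrier (ar S)"
  then show "cmp S (idt S (cd S u), u) = u"
    by (auto elim!: S_cases)
  obtain a x where ax: "u = \<phi> (a, x)" "a \<in> carrier (fibre M)" "x \<in> carrier (base M)"
    using u by (rule S_cases)
  then show "cmp S (u, idt S (dm S u)) = u"
    \<comment> \<open>To fit the shape of \<open>cmp_S\<close>, the object \<open>x\<close> is read
      as \<open>bdry M \<one> \<otimes> x\<close>.\<close>
    using cmp_S[of a "\<one>\<^bsub>fibre M\<^esub>" x] by (simp del: cmp_S)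
next
  fix u v w assume "u \<in> carrier (ar S)" "v \<in> carrier (ar S)" "w \<in> carrier (ar S)"
  then obtain a x b y c z where u: "u = \<phi> (a, x)" "a \<in> carrier (fibre M)" "x \<in> carrier (base M)"
    and v: "v = \<phi> (b, y)" "b \<in> carrier (fibre M)" "y \<in> carrier (base M)"
    and w: "w = \<phi> (c, z)" "c \<in> carrier (fibre M)" "z \<in> carrier (base M)"
    by (metis S_cases)
  show "dm S u = cd S v \<longrightarrow> dm S v = cd S w \<longrightarrow> cmp S (cmp S (u, v), w) = cmp S (u, cmp S (v, w))"
  proof (intro impI)
    assume "dm S u = cd S v" "dm S v = cd S w"
    then have x: "x = bdry M b \<otimes>\<^bsub>base M\<^esub> y" "y = bdry M c \<otimes>\<^bsub>base M\<^esub> z"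
      using u v w by simp_all
    \<comment> \<open>Makes \<open>u\<close> visibly composable with the composite of
      \<open>v\<close> and \<open>w\<close>, whose fibre component is
      \<open>b \<otimes> c\<close>.\<close>
    then have "x = bdry M (b \<otimes>\<^bsub>fibre M\<^esub> c) \<otimes>\<^bsub>base M\<^esub> z"
      using v w by (simp add: base.m_assoc)
    then have "cmp S (u, cmp S (v, w)) = \<phi> (a \<otimes>\<^bsub>fibre M\<^esub> (b \<otimes>\<^bsub>fibre M\<^esub> c), z)"
      using u v w x(2) by (simp del: bdry.hom_mult)
    moreover have "cmp S (cmp S (u, v), w) = \<phi> (a \<otimes>\<^bsub>fibre M\<^esub> b \<otimes>\<^bsub>fibre M\<^esub> c, z)"
      using u v w x(1) cmp_S[of a b y] by (simp add: x(2))
    ultimately show "cmp S (cmp S (u, v), w) = cmp S (u, cmp S (v, w))"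
      using u v w by (simp add: fibre.m_assoc)
  qed
next
  fix u assume "u \<in> pcone (ar S)"
  then obtain a x where u: "u = \<phi> (a, x)" "a \<in> pcone (fibre M)" "a \<in> carrier (fibre M)" "x \<in> carrier (base M)"
    by (rule pcone_S_cases)
  interpret S: group "ar S" by (rule rpogroupD(1)[OF rpogroup_S])
  \<comment> \<open>The kernel part of \<open>\<phi> (a, x)\<close> is thus
    \<open>\<phi> (a, \<one>)\<close>, positive because \<open>a\<close> is.\<close>
  have "inv\<^bsub>ar S\<^esub> \<phi> (\<one>\<^bsub>fibre M\<^esub>, x) = \<phi> (\<one>\<^bsub>fibre M\<^esub>, inv\<^bsub>base M\<^esub> x)"
    using u by (intro S.inv_equality) auto
  then show "u \<otimes>\<^bsub>ar S\<^esub> inv\<^bsub>ar S\<^esub> idt S (dm S u) \<in> pcone (ar S)"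
    using u rpogroupD(3)[OF rpogroup_base] by simp
qed (auto)

sublocale S: schreier_cat S
  by unfold_locales (rule schreier_category_S)

section \<open>Recovering a crossed module from its semidirect product\<close>

lemma carrier_ker_d_S: "carrier (ker_d S) = (\<lambda>a. \<phi> (a, \<one>\<^bsub>base M\<^esub>)) ` carrier (fibre M)"
  by (auto simp: S.ker_d_simps elim!: S_cases)

text \<open>A bijective morphism of right-preordered groups may fail to reflect the cone, so an
  isomorphism onto the fibre needs equality of cones here.\<close>

lemma pcone_ker_d_S: "pcone (ker_d S) = (\<lambda>a. \<phi> (a, \<one>\<^bsub>base M\<^esub>)) ` pcone (fibre M)"
  using rpogroupD(2)[OF rpogroup_fibre] rpogroupD(3)[OF rpogroup_base]
  by (auto simp: S.ker_d_simps elim!: pcone_S_cases)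

text \<open>The purpose of a semidirect product: the given action becomes conjugation.\<close>

lemma act_to_xmod_S:
  assumes x: "x \<in> carrier (base M)" and a: "a \<in> carrier (fibre M)"
  shows "act (to_xmod S) x (\<phi> (a, \<one>\<^bsub>base M\<^esub>)) = \<phi> (act M x a, \<one>\<^bsub>base M\<^esub>)"
proof -
  have "inv\<^bsub>ar S\<^esub> \<phi> (\<one>\<^bsub>fibre M\<^esub>, x) = \<phi> (\<one>\<^bsub>fibre M\<^esub>, inv\<^bsub>base M\<^esub> x)"
    using x by (intro S.ar.inv_equality) auto
  then show ?thesis
    using assms by (simp add: S.to_xmod_simps carrier_ker_d_S del: S.idt.hom_inv)
qed

lemma iso_to_xmod_S:
  "iso_arrow XMod (to_xmod S) M
    (\<lambda>x\<in>carrier (base M). x, \<lambda>u\<in>carrier (ker_d S). fst (inv_into UNIV \<phi> u))"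
  unfolding iso_arrow_def
proof (intro conjI bexI[of _ "(\<lambda>x\<in>carrier (base M). x, \<lambda>a\<in>carrier (fibre M). \<phi> (a, \<one>\<^bsub>base M\<^esub>))"])
  have id: "(\<lambda>x\<in>carrier (base M). x) \<in> rpo_hom (base M) (base M)"
    by (rule rpo_hom_id[OF rpogroup_base])
  have "(\<lambda>u\<in>carrier (ker_d S). fst (inv_into UNIV \<phi> u)) \<in> rpo_hom (ker_d S) (fibre M)"
    using rpogroupD(2)[OF rpogroup_fibre]
    by (intro rpo_homI) (auto simp: carrier_ker_d_S pcone_ker_d_S S.ker_d_simps(3) inj)
  then show "(\<lambda>x\<in>carrier (base M). x, \<lambda>u\<in>carrier (ker_d S). fst (inv_into UNIV \<phi> u)) \<in> Hom XMod (to_xmod S) M"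
    using id by (auto simp: XMod_simps xmod_homs_def S.to_xmod_simps(1-3) carrier_ker_d_S act_to_xmod_S inj)
  have "(\<lambda>a\<in>carrier (fibre M). \<phi> (a, \<one>\<^bsub>base M\<^esub>)) \<in> rpo_hom (fibre M) (ker_d S)"
    using rpogroupD(2)[OF rpogroup_fibre]
    by (intro rpo_homI) (auto simp: carrier_ker_d_S pcone_ker_d_S S.ker_d_simps(3))
  then show "(\<lambda>x\<in>carrier (base M). x, \<lambda>a\<in>carrier (fibre M). \<phi> (a, \<one>\<^bsub>base M\<^esub>)) \<in> Hom XMod M (to_xmod S)"
    using id by (auto simp: XMod_simps xmod_homs_def S.to_xmod_simps(1-3) carrier_ker_d_S act_to_xmod_S)
qed (auto simp: XMod_simps S.to_xmod_simps(1,2) compose_def carrier_ker_d_S inj fun_eq_iff)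

end

lemma to_xmod_ess_surj:
  assumes "infinite (UNIV :: 'u set)" "M \<in> Obj XMod"
  shows "\<exists>X\<in>Obj (SchCat :: (('u, 'u) intcat, _) cat). \<exists>f. iso_arrow XMod (to_xmod X) M f"
proof -
  \<comment> \<open>An infinite type has the cardinality of its square; this brings the semidirect
    product back into the universe.\<close>
  obtain \<phi> :: "'u \<times> 'u \<Rightarrow> 'u" where "inj \<phi>"
    using card_of_Times_same_infinite[OF assms(1)] unfolding card_of_ordIso[symmetric] bij_betw_def by auto
  then interpret semidirect_product M \<phi>
    using assms(2) by unfold_locales (simp_all add: XMod_simps)
  show ?thesis
    using schreier_category_S iso_to_xmod_S by (auto simp: SchCat_simps)
qed

section \<open>Transfer of the groupoid condition\<close>

lemma is_a_group_iso:
  assumes MN: "M \<in> Obj XMod" "N \<in> Obj XMod" and iso: "iso_arrow XMod M N f"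
    and N: "is_a_group (fibre N) (pcone (fibre N))"
  shows "is_a_group (fibre M) (pcone (fibre M))"
  unfolding is_a_group_def
proof
  interpret M: crossed_mod M using MN by unfold_locales (simp add: XMod_simps)
  interpret N: crossed_mod N using MN by unfold_locales (simp add: XMod_simps)
  obtain f0 f1 where [simp]: "f = (f0, f1)" by (cases f)
  obtain g0 g1 where f: "(f0, f1) \<in> xmod_homs M N" and g: "(g0, g1) \<in> xmod_homs N M"
    and "compose (carrier (fibre M)) g1 f1 = (\<lambda>a\<in>carrier (fibre M). a)"
    using iso by (auto simp: iso_arrow_def XMod_simps)
  then have gf: "g1 (f1 a) = a" if "a \<in> carrier (fibre M)" for a
    using that by (metis compose_eq restrict_apply')
  interpret f1: group_hom "fibre M" "fibre N" f1
    by (rule group_hom_rpo_hom[OF M.rpogroup_fibre N.rpogroup_fibre xmod_homsD(2)[OF f]])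
  fix a assume p: "a \<in> pcone (fibre M)"
  then have a: "a \<in> carrier (fibre M)" using rpogroupD(2)[OF M.rpogroup_fibre] by auto
  \<comment> \<open>The inverse of \<open>a\<close> is reached by a detour through \<open>N\<close>:
    it equals \<open>g1 (inv (f1 a))\<close>, and every stage of this stays in a cone.\<close>
  have "f1 a \<in> pcone (fibre N)"
    using p by (rule rpo_hom_pcone[OF xmod_homsD(2)[OF f]])
  then have "inv\<^bsub>fibre N\<^esub> f1 a \<in> pcone (fibre N)"
    using N by (simp add: is_a_group_def)
  then have "g1 (inv\<^bsub>fibre N\<^esub> f1 a) \<in> pcone (fibre M)"
    by (rule rpo_hom_pcone[OF xmod_homsD(2)[OF g]])
  then show "inv\<^bsub>fibre M\<^esub> a \<in> pcone (fibre M)"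
    using a gf[of "inv\<^bsub>fibre M\<^esub> a"] by simp
qed

text \<open>Rephrases the criterion inside \<open>ker_d X\<close>, where inverses agree with those
  of \<open>ar X\<close>.\<close>

lemma internal_groupoid_iff_to_xmod:
  assumes "X \<in> Obj SchCat"
  shows "internal_groupoid X \<longleftrightarrow> is_a_group (fibre (to_xmod X)) (pcone (fibre (to_xmod X)))"
proof -
  interpret X: schreier_cat X using assms by unfold_locales (simp add: SchCat_simps)
  show ?thesis
    using rpogroupD(2)[OF X.rpogroup_ar]
    unfolding X.internal_groupoid_iff is_a_group_def
    by (auto simp: X.to_xmod_simps(2) X.ker_d_simps(2) X.inv_ker_d kernel_def subset_iff)
qed

theorem mainTheorem16:
  assumes "infinite (UNIV :: 'u set)"
  shows "cat_equivalence (SchCat :: (('u, 'u) intcat, _) cat) XMod to_xmod to_xmod_arr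
       \<and> cat_equivalence (SchGrpd :: (('u, 'u) intcat, _) cat) XModGrp to_xmod to_xmod_arr
       \<and> (\<forall>X :: ('a, 'b) intcat. schreier_category X \<longrightarrow>
            (internal_groupoid X \<longleftrightarrow>
             is_a_group (ar X) (kernel (ar X) (ob X) (dm X) \<inter> pcone (ar X))))"
proof (intro conjI allI impI)
  show "cat_equivalence (SchCat :: (('u, 'u) intcat, _) cat) XMod to_xmod to_xmod_arr"
    by (rule cat_equivalence_if_fully_faithful_ess_surj
        [OF cat_functor_to_xmod to_xmod_arr_Hom_bij to_xmod_ess_surj[OF assms]])
  show "cat_equivalence (SchGrpd :: (('u, 'u) intcat, _) cat) XModGrp to_xmod to_xmod_arr"
    unfolding SchGrpd_def XModGrp_def
    by (rule cat_equivalence_full_subcat)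
      (assumption | rule cat_functor_to_xmod to_xmod_arr_Hom_bij to_xmod_ess_surj[OF assms]
        internal_groupoid_iff_to_xmod is_a_group_iso)+
  \<comment> \<open>No semidirect product is formed for this part, so the carrier types may be
    arbitrary.\<close>
  fix X :: "('a, 'b) intcat" assume "schreier_category X"
  then show "internal_groupoid X \<longleftrightarrow>
      is_a_group (ar X) (kernel (ar X) (ob X) (dm X) \<inter> pcone (ar X))"
    by (intro schreier_cat.internal_groupoid_iff schreier_cat.intro)
qed

end
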